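(* For all $\delta>0$ and $\epsilon>0$, the algorithm B-EquiSet-Edf is a $(1+\delta)^2(4+\epsilon)$-speed $(2+8/\epsilon)(1+1/\delta)^2$-competitive algorithm for the online data broadcast problem with dependencies, in which at most one item is broadcast at any given time and each broadcast is preempted at most once on average.
   Context: Online data broadcast problem with dependencies. An instance $\mathcal{S}$ consists of items $I_1,\dots,I_n$ with lengths $\ell_1,\dots,\ell_n>0$ and requests for non-empty sets $S_1,\dots,S_q\subseteq\{I_1,\dots,I_n\}$ with arrival times $a_1,\dots,a_q$. An $s$-speed schedule is a function $r:\{I_i\}\times[0,\infty)\to[0,s]$ with $\sum_i r(I_i,t)\le s$. Let $c(I_i,0)=0$, $c(I_i,k)$ the first date with $\int_0^{c(I_i,k)} r(I_i,t)dt=k\ell_i$, $b(I_i,k)=\inf\{t\ge c(I_i,k-1): r(I_i,t)>0\}$, and $C(I_i,t)=\min\{c(I_i,k): b(I_i,k)\ge t\}$. The completion time of $S_j$ is $c_j=\max_{I_i\in S_j}C(I_i,a_j)$, flow time is $\sum_j(c_j-a_j)$, and $\mathrm{BOPT}_1$ is the minimum flow time with bandwidth $1$. The algorithm is online and non-clairvoyant (learns $S_j$ at time $a_j$, does not know lengths, learns completion of a broadcast only when it occurs). An algorithm is $s$-speed $c$-competitive if its flow time with bandwidth $s$ is at most $c\cdot\mathrm{BOPT}_1$ on every instance. B-EquiSet with bandwidth $\sigma$: a request $S_j$ is alive at time $t$ if $t\ge a_j$ and some $I_i\in S_j$ has $t<C(I_i,a_j)$ (such $I_i$ is alive for $S_j$);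 with $R(t)$ the set of alive requests, each alive request gets bandwidth $\sigma/|R(t)|$, split arbitrarily among its alive items as rates $r_{j,i}(t)\ge 0$, and item $I_i$ is broadcast at rate $\sum_j r_{j,i}(t)$. B-EquiSet-Edf: let $s=(4+\epsilon)(1+\delta)^2$. It simulates the execution of B-EquiSet with bandwidth $s/(1+\delta)$. Each time $t$ at which a broadcast of an item $I_i$ in the simulation completes, where $t'$ is the time this broadcast began, it releases an item copy $I'_i$ of length $\ell_i$ with deadline $t+(t-t')/\delta$. It then broadcasts the released copies on bandwidth $s$ according to the earliest-deadline-first policy (one item at a time, preempting only when a newly released copy has an earlier deadline).
   Formalization: For B-EquiSet-Edf each released copy counts as its own broadcast, with its own begin and completion date, when flow time is measured; reading broadcasts off the summed rate r(I,t) of an item makes the competitive bound false when copies of one item overlap. *)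

theory Defs
  imports "HOL-Analysis.Analysis"
begin

record 'i broadcast_instance =
  items :: "'i set"
  len :: "'i \<Rightarrow> real"
  num_requests :: nat
  request :: "nat \<Rightarrow> 'i set"
  arrival :: "nat \<Rightarrow> real"

definition valid_instance :: "'i broadcast_instance \<Rightarrow> bool" where
  "valid_instance P \<longleftrightarrow>
     finite (items P) \<and> (\<forall>i\<in>items P. 0 < len P i) \<and>
     (\<forall>j<num_requests P. request P j \<noteq> {} \<and> request P j \<subseteq> items P \<and> 0 \<le> arrival P j)"

section \<open>Schedules, flow time and the optimum\<close>

text \<open>Time is the half-line \<open>[0, \<infinity>)\<close>; values at negative times are never looked at.
  Integrability on compact intervals is what makes the integrals defining the completion
  dates meaningful.\<close>

definition is_schedule :: "'i broadcast_instance \<Rightarrow> real \<Rightarrow> ('i \<Rightarrow> real \<Rightarrow> real) \<Rightarrow> bool" where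
  "is_schedule P s r \<longleftrightarrow>
     (\<forall>i\<in>items P. (\<forall>t\<ge>0. 0 \<le> r i t \<and> r i t \<le> s) \<and> (\<forall>T\<ge>0. r i integrable_on {0..T})) \<and>
     (\<forall>t\<ge>0. (\<Sum>i\<in>items P. r i t) \<le> s)"

text \<open>Dates are extended reals: \<open>\<infinity>\<close> is the date of an event that never happens
  (\<open>Inf {} = \<infinity>\<close>).  The following two are \<open>c(I, k)\<close> and, for \<open>k \<ge> 1\<close>, \<open>b(I, k)\<close>.\<close>

definition completion_date ::
    "'i broadcast_instance \<Rightarrow> ('i \<Rightarrow> real \<Rightarrow> real) \<Rightarrow> 'i \<Rightarrow> nat \<Rightarrow> ereal" where
  "completion_date P r i k = Inf {ereal t |t. 0 \<le> t \<and> integral {0..t} (r i) = real k * len P i}"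

definition begin_date ::
    "'i broadcast_instance \<Rightarrow> ('i \<Rightarrow> real \<Rightarrow> real) \<Rightarrow> 'i \<Rightarrow> nat \<Rightarrow> ereal" where
  "begin_date P r i k =
     Inf {ereal t |t. 0 \<le> t \<and> completion_date P r i (k - 1) \<le> ereal t \<and> 0 < r i t}"

definition broadcasts_of ::
    "'i broadcast_instance \<Rightarrow> ('i \<Rightarrow> real \<Rightarrow> real) \<Rightarrow> 'i \<Rightarrow> (ereal \<times> ereal) set" where
  "broadcasts_of P r i = {(begin_date P r i k, completion_date P r i k) |k. 1 \<le> k}"

text \<open>\<open>C(I, t)\<close>, as a function of the set of pairs (begin date, completion date) of the
  broadcasts of \<open>I\<close>.\<close>

definition reception_date :: "(ereal \<times> ereal) set \<Rightarrow> real \<Rightarrow> ereal" where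
  "reception_date B t = Inf {c. \<exists>b. (b, c) \<in> B \<and> ereal t \<le> b}"

definition request_completion ::
    "'i broadcast_instance \<Rightarrow> ('i \<Rightarrow> (ereal \<times> ereal) set) \<Rightarrow> nat \<Rightarrow> ereal" where
  "request_completion P B j = Max ((\<lambda>i. reception_date (B i) (arrival P j)) ` request P j)"

definition flow_time ::
    "'i broadcast_instance \<Rightarrow> ('i \<Rightarrow> (ereal \<times> ereal) set) \<Rightarrow> ereal" where
  "flow_time P B = (\<Sum>j<num_requests P. request_completion P B j - ereal (arrival P j))"

definition BOPT :: "real \<Rightarrow> 'i broadcast_instance \<Rightarrow> ereal" where
  "BOPT s P = (INF r\<in>{r. is_schedule P s r}. flow_time P (broadcasts_of P r))"

section \<open>Schedules of item copies\<close>

text \<open>A schedule that manipulates several copies of the same item gives a rate to each copy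
  \<open>(i, k)\<close> of an item \<open>i\<close>, and each copy is a broadcast of its own.  Adding up the rates of the
  copies of an item and reading the broadcasts off the sum would confuse a copy with a
  suspended older copy of the same item.\<close>

type_synonym 'i copy_rates = "'i \<times> nat \<Rightarrow> real \<Rightarrow> real"

definition broadcast_copies :: "'i copy_rates \<Rightarrow> ('i \<times> nat) set" where
  "broadcast_copies \<rho> = {x. \<exists>t\<ge>0. 0 < \<rho> x t}"

definition item_rate :: "'i copy_rates \<Rightarrow> 'i \<Rightarrow> real \<Rightarrow> real" where
  "item_rate \<rho> i t = (\<Sum>k\<in>{k. (i, k) \<in> broadcast_copies \<rho>}. \<rho> (i, k) t)"

definition is_copy_schedule :: "'i broadcast_instance \<Rightarrow> real \<Rightarrow> 'i copy_rates \<Rightarrow> bool" where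
  "is_copy_schedule P s \<rho> \<longleftrightarrow>
     finite (broadcast_copies \<rho>) \<and> fst ` broadcast_copies \<rho> \<subseteq> items P \<and>
     (\<forall>x. (\<forall>t\<ge>0. 0 \<le> \<rho> x t) \<and> (\<forall>T\<ge>0. \<rho> x integrable_on {0..T})) \<and>
     is_schedule P s (item_rate \<rho>)"

definition sent :: "'i copy_rates \<Rightarrow> 'i \<times> nat \<Rightarrow> real \<Rightarrow> real" where
  "sent \<rho> x t = integral {0..t} (\<rho> x)"

definition copy_begin_date :: "'i copy_rates \<Rightarrow> 'i \<times> nat \<Rightarrow> ereal" where
  "copy_begin_date \<rho> x = Inf {ereal t |t. 0 \<le> t \<and> 0 < \<rho> x t}"

definition copy_completion_date ::
    "'i broadcast_instance \<Rightarrow> 'i copy_rates \<Rightarrow> 'i \<times> nat \<Rightarrow> ereal" where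
  "copy_completion_date P \<rho> x = Inf {ereal t |t. 0 \<le> t \<and> sent \<rho> x t = len P (fst x)}"

definition copy_broadcasts_of ::
    "'i broadcast_instance \<Rightarrow> 'i copy_rates \<Rightarrow> 'i \<Rightarrow> (ereal \<times> ereal) set" where
  "copy_broadcasts_of P \<rho> i =
     {(copy_begin_date \<rho> (i, k), copy_completion_date P \<rho> (i, k)) |k.
        (i, k) \<in> broadcast_copies \<rho>}"

definition one_at_a_time :: "'i copy_rates \<Rightarrow> bool" where
  "one_at_a_time \<rho> \<longleftrightarrow> (\<forall>t\<ge>0. \<forall>x y. 0 < \<rho> x t \<and> 0 < \<rho> y t \<longrightarrow> x = y)"

text \<open>Pairs of a copy and a date at which its broadcast is interrupted although it is not yet
  complete.\<close>

definition preemptions ::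
    "'i broadcast_instance \<Rightarrow> 'i copy_rates \<Rightarrow> (('i \<times> nat) \<times> real) set" where
  "preemptions P \<rho> =
     {(x, u). 0 < u \<and> (\<exists>\<^sub>F t in at_left u. 0 < \<rho> x t) \<and> \<not> 0 < \<rho> x u \<and>
              sent \<rho> x u < len P (fst x)}"

definition preempted_at_most_once_on_average ::
    "'i broadcast_instance \<Rightarrow> 'i copy_rates \<Rightarrow> bool" where
  "preempted_at_most_once_on_average P \<rho> \<longleftrightarrow>
     finite (broadcast_copies \<rho>) \<and> finite (preemptions P \<rho>) \<and>
     card (preemptions P \<rho>) \<le> card (broadcast_copies \<rho>)"

section \<open>Algorithms\<close>

text \<open>An algorithm with unspecified choices is the set of its possible outcomes on each
  instance; it must have an outcome on every instance, and be competitive whatever the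
  choices.\<close>

type_synonym 'i algorithm = "'i broadcast_instance \<Rightarrow> 'i copy_rates set"

definition competitive :: "real \<Rightarrow> real \<Rightarrow> 'i algorithm \<Rightarrow> bool" where
  "competitive s c A \<longleftrightarrow>
     (\<forall>P. valid_instance P \<longrightarrow>
        A P \<noteq> {} \<and>
        (\<forall>\<rho>\<in>A P. is_copy_schedule P s \<rho> \<and>
                 flow_time P (copy_broadcasts_of P \<rho>) \<le> ereal c * BOPT 1 P))"

subsection \<open>B-EquiSet\<close>

definition alive_item ::
    "'i broadcast_instance \<Rightarrow> ('i \<Rightarrow> real \<Rightarrow> real) \<Rightarrow> real \<Rightarrow> nat \<Rightarrow> 'i \<Rightarrow> bool" where
  "alive_item P r t j i \<longleftrightarrow>
     i \<in> request P j \<and> arrival P j \<le> t \<and>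
     ereal t < reception_date (broadcasts_of P r i) (arrival P j)"

definition alive_requests ::
    "'i broadcast_instance \<Rightarrow> ('i \<Rightarrow> real \<Rightarrow> real) \<Rightarrow> real \<Rightarrow> nat set" where
  "alive_requests P r t = {j. j < num_requests P \<and> (\<exists>i. alive_item P r t j i)}"

definition total_rate ::
    "'i broadcast_instance \<Rightarrow> (nat \<Rightarrow> 'i \<Rightarrow> real \<Rightarrow> real) \<Rightarrow> 'i \<Rightarrow> real \<Rightarrow> real" where
  "total_rate P w i t = (\<Sum>j<num_requests P. w j i t)"

text \<open>\<open>w j i t\<close> is the rate \<open>r\<^bsub>j,i\<^esub>(t)\<close> that request \<open>j\<close> devotes to item \<open>i\<close>.  Whether an item is
  alive at \<open>t\<close> is determined by the rates before \<open>t\<close>, so that this fixed-point condition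
  describes exactly the executions of the algorithm.\<close>

definition b_equiset ::
    "real \<Rightarrow> 'i broadcast_instance \<Rightarrow> (nat \<Rightarrow> 'i \<Rightarrow> real \<Rightarrow> real) \<Rightarrow> bool" where
  "b_equiset \<sigma> P w \<longleftrightarrow>
     (\<forall>j<num_requests P. \<forall>i\<in>items P. \<forall>T\<ge>0. w j i integrable_on {0..T}) \<and>
     (\<forall>t\<ge>0. \<forall>j<num_requests P.
        (\<forall>i\<in>items P. 0 \<le> w j i t \<and> (\<not> alive_item P (total_rate P w) t j i \<longrightarrow> w j i t = 0)) \<and>
        (j \<in> alive_requests P (total_rate P w) t \<longrightarrow>
           (\<Sum>i\<in>request P j. w j i t) = \<sigma> / real (card (alive_requests P (total_rate P w) t))))"

subsection \<open>B-EquiSet-Edf\<close>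

text \<open>The copy \<open>(i, k)\<close> is released when the \<open>k\<close>-th broadcast of \<open>i\<close> completes in the
  simulated schedule \<open>r\<close>.\<close>

definition released_copies ::
    "'i broadcast_instance \<Rightarrow> ('i \<Rightarrow> real \<Rightarrow> real) \<Rightarrow> ('i \<times> nat) set" where
  "released_copies P r = {(i, k). i \<in> items P \<and> 1 \<le> k \<and> completion_date P r i k < \<infinity>}"

definition release :: "'i broadcast_instance \<Rightarrow> ('i \<Rightarrow> real \<Rightarrow> real) \<Rightarrow> 'i \<times> nat \<Rightarrow> real" where
  "release P r x = real_of_ereal (completion_date P r (fst x) (snd x))"

definition deadline ::
    "real \<Rightarrow> 'i broadcast_instance \<Rightarrow> ('i \<Rightarrow> real \<Rightarrow> real) \<Rightarrow> 'i \<times> nat \<Rightarrow> real" where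
  "deadline \<delta> P r x =
     release P r x + (release P r x - real_of_ereal (begin_date P r (fst x) (snd x))) / \<delta>"

definition pending ::
    "'i broadcast_instance \<Rightarrow> ('i \<Rightarrow> real \<Rightarrow> real) \<Rightarrow> 'i copy_rates \<Rightarrow> real \<Rightarrow> ('i \<times> nat) set" where
  "pending P r \<rho> t =
     {x \<in> released_copies P r. release P r x \<le> t \<and> sent \<rho> x t < len P (fst x)}"

text \<open>The last conjunct settles ties: a copy being broadcast goes on as long as it is incomplete
  and no copy with a strictly earlier deadline has been released since.\<close>

definition edf ::
    "real \<Rightarrow> real \<Rightarrow> 'i broadcast_instance \<Rightarrow> ('i \<Rightarrow> real \<Rightarrow> real) \<Rightarrow> 'i copy_rates \<Rightarrow> bool" where
  "edf s \<delta> P r \<rho> \<longleftrightarrow>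
     (\<forall>x. \<forall>T\<ge>0. \<rho> x integrable_on {0..T}) \<and>
     (\<forall>t\<ge>0. pending P r \<rho> t = {} \<longrightarrow> (\<forall>x. \<rho> x t = 0)) \<and>
     (\<forall>t\<ge>0. pending P r \<rho> t \<noteq> {} \<longrightarrow>
        (\<exists>x\<in>pending P r \<rho> t.
           (\<forall>y\<in>pending P r \<rho> t. deadline \<delta> P r x \<le> deadline \<delta> P r y) \<and>
           \<rho> x t = s \<and> (\<forall>y. y \<noteq> x \<longrightarrow> \<rho> y t = 0))) \<and>
     (\<forall>x t u. 0 \<le> t \<and> t < u \<and> 0 < \<rho> x t \<and> x \<in> pending P r \<rho> u \<and>
        \<not> (\<exists>y\<in>released_copies P r. t < release P r y \<and> release P r y \<le> u \<and>
                deadline \<delta> P r y < deadline \<delta> P r x)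
        \<longrightarrow> 0 < \<rho> x u)"

definition b_equiset_edf :: "real \<Rightarrow> real \<Rightarrow> 'i algorithm" where
  "b_equiset_edf \<delta> \<epsilon> P =
     (let s = (4 + \<epsilon>) * (1 + \<delta>)\<^sup>2
      in {\<rho>. \<exists>w. b_equiset (s / (1 + \<delta>)) P w \<and> edf s \<delta> P (total_rate P w) \<rho>})"

end

theory Submission
  imports Defs
begin

text \<open>B-EquiSet with bandwidth \<open>\<sigma> > 4\<close> has flow time at most \<open>2 \<sigma> / (\<sigma> - 4)\<close> times that of any schedule
  with bandwidth 1, called the optimum here.  Call an alive request late once the optimum has completed
  it, and let its rank be the number of alive requests that arrived no later.  If \<open>n\<close> requests are alive
  and \<open>m\<close> are alive in the optimum, then at least \<open>n - m\<close> are late, so the bandwidth given to late requests,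
  weighted by ranks, is at least \<open>(\<sigma> / n) (n - m)\<^sup>2 / 2 \<ge> \<sigma> (n - 2 m) / 2\<close>.  On the other hand the bandwidth that late
  requests spend on an item \<open>i\<close> is charged to the broadcast of \<open>i\<close> that served them in the optimum: it amounts to
  at most two lengths of \<open>i\<close>, and its weights are at most the number of requests alive throughout that
  broadcast.  So the weighted bandwidth totals at most \<open>2 \<integral> n\<close>, and integrating the first bound gives the claim.

  EDF meets all deadlines: the copies released after \<open>u\<close> with deadline before \<open>v\<close> were broadcast in the
  simulation, at bandwidth \<open>s / (1 + \<delta>)\<close>, during an interval of length \<open>(1 + \<delta>) (v - u)\<close>, so that no busy interval
  is overloaded.  This stretches every flow time by at most \<open>1 + 1 / \<delta>\<close>.\<close>

section \<open>Broadcasts of one item\<close>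

lemma integral_initial_segment:
  fixes g :: "real \<Rightarrow> real"
  assumes "u \<le> T" and g: "g integrable_on {u..T}"
    and down: "\<And>s t. u \<le> s \<Longrightarrow> s \<le> t \<Longrightarrow> t \<le> T \<Longrightarrow> A t \<Longrightarrow> A s"
  obtains \<tau> where "u \<le> \<tau>" "\<tau> \<le> T" "\<And>t. u \<le> t \<Longrightarrow> t < \<tau> \<Longrightarrow> A t"
    "\<And>t. \<tau> < t \<Longrightarrow> t \<le> T \<Longrightarrow> \<not> A t"
    "((\<lambda>t. if A t then g t else 0) has_integral integral {u..\<tau>} g) {u..T}"
proof -
  define S where "S = insert u {t \<in> {u..T}. A t}"
  define \<tau> where "\<tau> = Sup S"
  have bdd: "bdd_above S" unfolding S_def by (auto intro!: bdd_aboveI[of _ T] simp: assms)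
  have ne: "S \<noteq> {}" unfolding S_def by auto
  have 1: "u \<le> \<tau>" unfolding \<tau>_def by (rule cSup_upper) (auto simp: bdd, simp add: S_def)
  have 2: "\<tau> \<le> T" unfolding \<tau>_def by (rule cSup_least) (use ne assms in \<open>auto simp: S_def\<close>)
  have 3: "A t" if "u \<le> t" "t < \<tau>" for t
  proof -
    have "\<exists>x\<in>S. t < x" using that(2) unfolding \<tau>_def less_cSup_iff[OF ne bdd] .
    then obtain x where "x \<in> S" "t < x" by blast
    then have "x \<in> {u..T}" "A x" using that by (auto simp: S_def)
    then show ?thesis using down[of t x] that \<open>t < x\<close> by auto
  qed
  have 4: "\<not> A t" if "\<tau> < t" "t \<le> T" for t
  proof
    assume "A t"
    then have "t \<in> S" using that 1 by (auto simp: S_def)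
    then show False using cSup_upper[OF _ bdd] that \<tau>_def by fastforce
  qed
  let ?f = "\<lambda>t. if A t then g t else 0"
  have "g integrable_on {u..\<tau>}" by (rule integrable_on_subinterval[OF g]) (use 1 2 in auto)
  then have "(g has_integral integral {u..\<tau>} g) {u..\<tau>}" by (rule integrable_integral)
  then have "(?f has_integral integral {u..\<tau>} g) {u..\<tau>}"
    by (rule has_integral_spike_finite[of "{\<tau>}", rotated 2]) (use 3 in auto)
  moreover have "(?f has_integral 0) {\<tau>..T}"
    by (rule has_integral_spike_finite[of "{\<tau>}", rotated 2, OF has_integral_0]) (use 4 in auto)
  ultimately have "(?f has_integral integral {u..\<tau>} g + 0) {u..T}"
    by (rule has_integral_combine[OF 1 2])
  then show ?thesis using that 1 2 3 4 by simp
qed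

lemma integrable_if_less:
  fixes f :: "real \<Rightarrow> real"
  assumes "f integrable_on {u..T}"
  shows "(\<lambda>t. if t < c then f t else 0) integrable_on {u..T}"
proof (cases "u \<le> T")
  case True
  show ?thesis
    by (rule integral_initial_segment[OF True assms, of "\<lambda>t. t < c"]) (auto intro: has_integral_integrable)
qed (use assms in auto)

lemma integrable_if_ge:
  fixes f :: "real \<Rightarrow> real"
  assumes "f integrable_on {u..T}"
  shows "(\<lambda>t. if a \<le> t then f t else 0) integrable_on {u..T}"
proof -
  have "(\<lambda>t. f t - (if t < a then f t else 0)) integrable_on {u..T}"
    by (intro integrable_diff integrable_if_less assms)
  then show ?thesis by (rule integrable_eq) auto
qed

lemma integrable_if_between:
  fixes f :: "real \<Rightarrow> real"
  assumes "f integrable_on {u..T}"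
  shows "(\<lambda>t. if a \<le> t \<and> t < c then f t else 0) integrable_on {u..T}"
proof -
  have "(\<lambda>t. if a \<le> t then if t < c then f t else 0 else 0) integrable_on {u..T}"
    by (intro integrable_if_ge integrable_if_less assms)
  then show ?thesis by (rule integrable_eq) auto
qed

lemma integral_down_closed_le:
  fixes g :: "real \<Rightarrow> real"
  assumes "u \<le> T" and g: "g integrable_on {u..T}"
    and down: "\<And>s t. u \<le> s \<Longrightarrow> s \<le> t \<Longrightarrow> t \<le> T \<Longrightarrow> A t \<Longrightarrow> A s"
    and bound: "\<And>t. u \<le> t \<Longrightarrow> t \<le> T \<Longrightarrow> A t \<Longrightarrow> integral {u..t} g \<le> V" and "0 \<le> V"
  shows "(\<lambda>t. if A t then g t else 0) integrable_on {u..T}"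
    and "integral {u..T} (\<lambda>t. if A t then g t else 0) \<le> V"
proof -
  obtain \<tau> where \<tau>: "u \<le> \<tau>" "\<tau> \<le> T" "\<And>t. u \<le> t \<Longrightarrow> t < \<tau> \<Longrightarrow> A t"
    and int: "((\<lambda>t. if A t then g t else 0) has_integral integral {u..\<tau>} g) {u..T}"
    by (rule integral_initial_segment[OF \<open>u \<le> T\<close> g, of A]) (use down in auto)
  show "(\<lambda>t. if A t then g t else 0) integrable_on {u..T}" using int by (rule has_integral_integrable)
  have "integral {u..\<tau>} g \<le> V"
  proof (cases "u = \<tau>")
    case False
    with \<tau> have "u < \<tau>" by simp
    have "continuous_on {u..\<tau>} (\<lambda>t. integral {u..t} g)"
      by (rule indefinite_integral_continuous_1, rule integrable_on_subinterval[OF g]) (use \<tau> in auto)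
    then have "((\<lambda>t. integral {u..t} g) \<longlongrightarrow> integral {u..\<tau>} g) (at \<tau> within {u..\<tau>})"
      using \<tau> by (auto simp: continuous_on_def)
    then have "((\<lambda>t. integral {u..t} g) \<longlongrightarrow> integral {u..\<tau>} g) (at_left \<tau>)"
      using \<open>u < \<tau>\<close> at_within_Icc_at_left by metis
    moreover have "\<forall>\<^sub>F t in at_left \<tau>. integral {u..t} g \<le> V"
      using eventually_at_left_real[OF \<open>u < \<tau>\<close>] by eventually_elim (use bound \<tau> in auto)
    ultimately show ?thesis by (rule tendsto_upperbound) simp
  qed (use \<open>0 \<le> V\<close> in auto)
  then show "integral {u..T} (\<lambda>t. if A t then g t else 0) \<le> V" using int by (simp add: integral_unique)
qed

locale broadcast_item =
  fixes P :: "'i broadcast_instance" and r :: "'i \<Rightarrow> real \<Rightarrow> real" and i :: 'i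
  assumes len_pos: "0 < len P i"
    and rate_nonneg: "\<And>t. 0 \<le> t \<Longrightarrow> 0 \<le> r i t"
    and rate_integrable: "\<And>T. 0 \<le> T \<Longrightarrow> r i integrable_on {0..T}"
begin

definition vol :: "real \<Rightarrow> real" where "vol t = integral {0..t} (r i)"

lemma rate_integrable_sub: "0 \<le> a \<Longrightarrow> r i integrable_on {a..b}"
proof (cases "a \<le> b")
  case True
  assume "0 \<le> a"
  with True show ?thesis by (intro integrable_on_subinterval[OF rate_integrable[of b]]) auto
qed auto

lemma vol_0 [simp]: "vol 0 = 0" by (simp add: vol_def)

lemma vol_diff: "0 \<le> a \<Longrightarrow> a \<le> b \<Longrightarrow> integral {a..b} (r i) = vol b - vol a"
  using Henstock_Kurzweil_Integration.integral_combine[OF _ _ rate_integrable[of b], of a] by (simp add: vol_def)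

lemma vol_mono: "0 \<le> a \<Longrightarrow> a \<le> b \<Longrightarrow> vol a \<le> vol b"
  using vol_diff[of a b] integral_nonneg[OF rate_integrable_sub[of a b]] rate_nonneg by force

lemma vol_nonneg: "0 \<le> t \<Longrightarrow> 0 \<le> vol t"
  using vol_mono[of 0 t] by simp

lemma vol_continuous: "continuous_on {0..T} vol"
  unfolding vol_def by (rule indefinite_integral_continuous_1, rule rate_integrable_sub) simp

lemma vol_ivt:
  assumes "0 \<le> t" "0 \<le> y" "y \<le> vol t"
  obtains c where "0 \<le> c" "c \<le> t" "vol c = y" "\<And>u. 0 \<le> u \<Longrightarrow> u < c \<Longrightarrow> vol u < y"
proof -
  let ?S = "{c \<in> {0..t}. vol c = y}"
  have "\<exists>c\<ge>0. c \<le> t \<and> vol c = y"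
    by (rule IVT') (use assms vol_continuous in auto)
  then have ne: "?S \<noteq> {}" by auto
  have "closed ?S"
    by (rule continuous_closed_preimage_constant[OF vol_continuous]) simp
  moreover have "bounded ?S" by (rule bounded_subset[OF bounded_closed_interval[of 0 t]]) auto
  ultimately have "compact ?S" by (simp add: compact_eq_bounded_closed)
  then obtain c where c: "c \<in> ?S" "\<And>x. x \<in> ?S \<Longrightarrow> c \<le> x" using compact_attains_inf[OF _ ne] by blast
  moreover have "vol u < y" if "0 \<le> u" "u < c" for u
  proof -
    have "vol u \<le> y" using vol_mono[of u c] that c by auto
    moreover have "vol u \<noteq> y" using c(2)[of u] that c(1) by auto
    ultimately show ?thesis by simp
  qed
  ultimately show ?thesis using that by auto
qed

lemma completion_le_iff:
  assumes "0 \<le> t"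
  shows "completion_date P r i k \<le> ereal t \<longleftrightarrow> real k * len P i \<le> vol t"
proof
  assume "real k * len P i \<le> vol t"
  then obtain c where c: "0 \<le> c" "c \<le> t" "vol c = real k * len P i"
    using vol_ivt[OF assms, of "real k * len P i"] len_pos by (metis less_eq_real_def mult_nonneg_nonneg of_nat_0_le_iff)
  then have "completion_date P r i k \<le> ereal c"
    unfolding completion_date_def vol_def by (intro Inf_lower) auto
  then show "completion_date P r i k \<le> ereal t" using c by (metis ereal_less_eq(3) order_trans)
next
  assume le: "completion_date P r i k \<le> ereal t"
  show "real k * len P i \<le> vol t"
  proof (rule ccontr)
    assume n: "\<not> ?thesis"
    have "completion_date P r i k < \<infinity>" using le by auto
    then obtain T where T: "0 \<le> T" "vol T = real k * len P i"
      unfolding completion_date_def vol_def Inf_less_iff by auto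
    then obtain c where c: "0 \<le> c" "c \<le> T" "vol c = real k * len P i"
      "\<And>u. 0 \<le> u \<Longrightarrow> u < c \<Longrightarrow> vol u < real k * len P i"
      using vol_ivt[of T "real k * len P i"] len_pos by auto
    have "ereal c \<le> completion_date P r i k"
      unfolding completion_date_def using c(4) by (intro Inf_greatest) (force simp: vol_def not_le)
    then have "c \<le> t" using le by (metis ereal_less_eq(3) order_trans)
    then show False using vol_mono[OF c(1)] c n by fastforce
  qed
qed

lemma completion_nonneg: "0 \<le> completion_date P r i k"
  unfolding completion_date_def by (intro Inf_greatest) auto

lemma completion_finite:
  assumes "completion_date P r i k \<noteq> \<infinity>"
  obtains c where "completion_date P r i k = ereal c" "0 \<le> c" "vol c = real k * len P i"
proof -
  obtain c where c: "completion_date P r i k = ereal c" "0 \<le> c"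
    using assms completion_nonneg[of k] by (cases "completion_date P r i k") auto
  then have "real k * len P i \<le> vol c" using completion_le_iff by fastforce
  then obtain d where d: "0 \<le> d" "d \<le> c" "vol d = real k * len P i"
    using vol_ivt[OF c(2), of "real k * len P i"] len_pos
    by (metis less_eq_real_def mult_nonneg_nonneg of_nat_0_le_iff)
  then have "completion_date P r i k \<le> ereal d" using completion_le_iff by simp
  then show ?thesis using that c d by auto
qed

lemma completion_mono: "k \<le> m \<Longrightarrow> completion_date P r i k \<le> completion_date P r i m"
proof (cases "completion_date P r i m = \<infinity>")
  case False
  assume "k \<le> m"
  obtain c where c: "completion_date P r i m = ereal c" "0 \<le> c" "vol c = real m * len P i"
    using completion_finite[OF False] .
  then have "real k * len P i \<le> vol c" using \<open>k \<le> m\<close> len_pos by simp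
  then show ?thesis using c completion_le_iff by simp
qed auto

lemma begin_ge_completion: "completion_date P r i (k - 1) \<le> begin_date P r i k"
  unfolding begin_date_def by (intro Inf_greatest) auto

lemma begin_ge_iff:
  "ereal a \<le> begin_date P r i k \<longleftrightarrow>
     (\<forall>\<tau>. 0 \<le> \<tau> \<and> \<tau> < a \<and> real (k - 1) * len P i \<le> vol \<tau> \<longrightarrow> \<not> 0 < r i \<tau>)"
  (is "?L \<longleftrightarrow> ?R")
proof
  assume ?L
  show ?R
  proof (intro allI impI notI)
    fix \<tau> assume t: "0 \<le> \<tau> \<and> \<tau> < a \<and> real (k - 1) * len P i \<le> vol \<tau>" "0 < r i \<tau>"
    then have "begin_date P r i k \<le> ereal \<tau>"
      unfolding begin_date_def by (intro Inf_lower) (auto simp: completion_le_iff)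
    then show False using \<open>?L\<close> t by (metis ereal_less_eq(3) leD order_trans)
  qed
next
  assume R: ?R
  show ?L unfolding begin_date_def
  proof (rule Inf_greatest)
    fix z assume "z \<in> {ereal t |t. 0 \<le> t \<and> completion_date P r i (k - 1) \<le> ereal t \<and> 0 < r i t}"
    then obtain t where t: "z = ereal t" "0 \<le> t" "completion_date P r i (k - 1) \<le> ereal t" "0 < r i t"
      by auto
    then show "ereal a \<le> z" using R completion_le_iff[of t "k - 1"] by force
  qed
qed

lemma broadcast_interval:
  assumes "1 \<le> k" and fin: "completion_date P r i k \<noteq> \<infinity>"
  obtains b c where "begin_date P r i k = ereal b" "completion_date P r i k = ereal c"
    "0 \<le> b" "b < c" "vol b = real (k - 1) * len P i" "vol c = real k * len P i"
proof -
  obtain c where c: "completion_date P r i k = ereal c" "0 \<le> c" "vol c = real k * len P i"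
    using completion_finite[OF fin] .
  have "completion_date P r i (k - 1) \<noteq> \<infinity>"
    using completion_mono[of "k - 1" k] c by auto
  then obtain c' where c': "completion_date P r i (k - 1) = ereal c'" "0 \<le> c'" "vol c' = real (k - 1) * len P i"
    using completion_finite by blast
  have lt: "real (k - 1) * len P i < real k * len P i" using \<open>1 \<le> k\<close> len_pos by simp
  have flat: "vol x = real (k - 1) * len P i" if "c' \<le> x" "ereal x \<le> begin_date P r i k" for x
  proof -
    have "integral {c'..x} (r i) = integral {c'..x} (\<lambda>_. 0)"
    proof (rule integral_spike[where S = "{x}"])
      fix t assume t: "t \<in> {c'..x} - {x}"
      then have "real (k - 1) * len P i \<le> vol t" using vol_mono[of c' t] c' by auto
      then have "\<not> 0 < r i t" using that(2) t c' unfolding begin_ge_iff by auto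
      then show "0 = r i t" using rate_nonneg[of t] t c' by auto
    qed auto
    then show ?thesis using vol_diff[of c' x] c' that by simp
  qed
  have "begin_date P r i k < ereal c"
  proof (rule ccontr)
    assume "\<not> ?thesis"
    moreover have "c' \<le> c" using completion_mono[of "k - 1" k] c c' by auto
    ultimately have "vol c = real (k - 1) * len P i" using flat[of c] by simp
    then show False using c(3) lt by linarith
  qed
  moreover have "ereal c' \<le> begin_date P r i k" using begin_ge_completion[of k] c' by simp
  ultimately obtain b where b: "begin_date P r i k = ereal b" "c' \<le> b" "b < c"
    by (cases "begin_date P r i k") auto
  then show ?thesis using that[OF b(1) c(1)] c c' flat[of b] by auto
qed

lemma reception_le_iff:
  assumes "0 \<le> t"
  shows "reception_date (broadcasts_of P r i) a \<le> ereal t \<longleftrightarrow>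
    (\<exists>k\<ge>1. ereal a \<le> begin_date P r i k \<and> real k * len P i \<le> vol t)" (is "?L \<longleftrightarrow> ?R")
proof
  assume ?R
  then obtain k where k: "1 \<le> k" "ereal a \<le> begin_date P r i k" "completion_date P r i k \<le> ereal t"
    using completion_le_iff[OF assms] by blast
  then have "reception_date (broadcasts_of P r i) a \<le> completion_date P r i k"
    unfolding reception_date_def broadcasts_of_def by (intro Inf_lower) auto
  then show ?L using k by auto
next
  assume L: ?L
  let ?Q = "\<lambda>k. 1 \<le> k \<and> ereal a \<le> begin_date P r i k"
  have "\<exists>k. ?Q k"
  proof (rule ccontr)
    assume "\<not> ?thesis"
    then have "{c. \<exists>b. (b, c) \<in> broadcasts_of P r i \<and> ereal a \<le> b} = {}"
      by (auto simp: broadcasts_of_def)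
    then show False using L unfolding reception_date_def by (simp only:) (simp add: top_ereal_def)
  qed
  then have Q: "?Q (LEAST k. ?Q k)" by (rule LeastI_ex)
  have "completion_date P r i (LEAST k. ?Q k) \<le> reception_date (broadcasts_of P r i) a"
    unfolding reception_date_def
  proof (rule Inf_greatest)
    fix c assume "c \<in> {c. \<exists>b. (b, c) \<in> broadcasts_of P r i \<and> ereal a \<le> b}"
    then obtain k where "?Q k" "c = completion_date P r i k" by (auto simp: broadcasts_of_def)
    then show "completion_date P r i (LEAST k. ?Q k) \<le> c"
      using completion_mono Least_le[of ?Q k] by simp
  qed
  then have "completion_date P r i (LEAST k. ?Q k) \<le> ereal t" using L by auto
  then show ?R using Q completion_le_iff[OF assms] by blast
qed

lemma reception_ge: "ereal a \<le> reception_date (broadcasts_of P r i) a"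
  unfolding reception_date_def
proof (rule Inf_greatest)
  fix c assume "c \<in> {c. \<exists>b. (b, c) \<in> broadcasts_of P r i \<and> ereal a \<le> b}"
  then obtain k where k: "1 \<le> k" "ereal a \<le> begin_date P r i k" "c = completion_date P r i k"
    by (auto simp: broadcasts_of_def)
  show "ereal a \<le> c"
  proof (cases "c = \<infinity>")
    case False
    then obtain b d where "begin_date P r i k = ereal b" "completion_date P r i k = ereal d" "b < d"
      using broadcast_interval[of k] k by metis
    then show ?thesis using k by auto
  qed auto
qed

lemma reception_attained:
  assumes "reception_date (broadcasts_of P r i) a \<noteq> \<infinity>" "0 \<le> a"
  obtains k where "1 \<le> k" "ereal a \<le> begin_date P r i k"
    "completion_date P r i k = reception_date (broadcasts_of P r i) a"
proof -
  obtain d where d: "reception_date (broadcasts_of P r i) a = ereal d" "a \<le> d"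
    using assms reception_ge[of a] by (cases "reception_date (broadcasts_of P r i) a") auto
  then obtain k where k: "1 \<le> k" "ereal a \<le> begin_date P r i k" "real k * len P i \<le> vol d"
    using reception_le_iff[of d a] assms by auto
  then have "completion_date P r i k \<le> ereal d" using completion_le_iff[of d] d assms by auto
  moreover have "ereal d \<le> completion_date P r i k" unfolding d(1)[symmetric] reception_date_def broadcasts_of_def
    using k by (intro Inf_lower) auto
  ultimately show ?thesis using that k d by auto
qed

text \<open>After \<open>u \<ge> a\<close> at most the broadcast in progress and one full broadcast are needed to serve
  a request that arrived at \<open>a\<close>.\<close>

lemma vol_before_reception:
  assumes "0 \<le> a" "a \<le> u" "u \<le> t" "ereal t < reception_date (broadcasts_of P r i) a"
  shows "vol t - vol u < 2 * len P i"
proof (rule ccontr)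
  assume n: "\<not> ?thesis"
  define k where "k = nat \<lfloor>vol u / len P i\<rfloor> + 1"
  have "0 \<le> vol u / len P i" using len_pos vol_nonneg[of u] assms by simp
  then have "real k - 1 \<le> vol u / len P i" "vol u / len P i < real k" unfolding k_def by linarith+
  then have k: "(real k - 1) * len P i \<le> vol u" "vol u < real k * len P i"
    using len_pos by (simp_all add: field_simps)
  have "\<not> completion_date P r i k \<le> ereal u" using completion_le_iff[of u k] k assms by auto
  then have "ereal a \<le> begin_date P r i (k + 1)"
    using begin_ge_completion[of "k + 1"] assms(2) by (cases "completion_date P r i k"; cases "begin_date P r i (k + 1)") auto
  moreover have "real (k + 1) * len P i \<le> vol t" using n k by (simp add: algebra_simps)
  ultimately have "reception_date (broadcasts_of P r i) a \<le> ereal t"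
    using reception_le_iff[of t a] assms by fastforce
  then show False using assms by auto
qed

lemma completions_between:
  assumes fin: "finite K" and K: "\<And>k. k \<in> K \<Longrightarrow> 1 \<le> k \<and> ereal \<alpha> \<le> begin_date P r i k \<and> completion_date P r i k \<le> ereal \<beta>"
    and "0 \<le> \<alpha>" "\<alpha> \<le> \<beta>"
  shows "real (card K) * len P i \<le> vol \<beta> - vol \<alpha>"
proof (cases "K = {}")
  case False
  define m M where "m = Min K" and "M = Max K"
  have mM: "m \<in> K" "M \<in> K" "m \<le> M" and sub: "K \<subseteq> {m..M}" using fin False by (auto simp: m_def M_def)
  have "card K \<le> Suc M - m" using card_mono[OF _ sub] by simp
  then have "real (card K) \<le> real M - (real m - 1)" using mM by linarith
  then have "real (card K) * len P i \<le> (real M - (real m - 1)) * len P i" using len_pos by simp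
  moreover have "real M * len P i \<le> vol \<beta>" using completion_le_iff[of \<beta> M] K[OF mM(2)] assms by auto
  moreover have "vol \<alpha> \<le> (real m - 1) * len P i"
  proof -
    have "completion_date P r i m \<noteq> \<infinity>" using K[OF mM(1)] by auto
    then obtain b where "begin_date P r i m = ereal b" "0 \<le> b" "vol b = real (m - 1) * len P i"
      using broadcast_interval[of m] K[OF mM(1)] by metis
    then show ?thesis using vol_mono[of \<alpha> b] K[OF mM(1)] assms by auto
  qed
  ultimately show ?thesis by (simp add: algebra_simps)
qed (use vol_mono assms in auto)

end

section \<open>Executions of B-EquiSet\<close>

lemma integral_if_between:
  fixes f :: "real \<Rightarrow> real"
  assumes "u \<le> a" "c \<le> T"
  shows "integral {u..T} (\<lambda>t. if a \<le> t \<and> t < c then f t else 0) = integral {a..c} f"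
proof -
  have "integral {u..T} (\<lambda>t. if a \<le> t \<and> t < c then f t else 0)
      = integral {u..T} (\<lambda>t. if t \<in> {a..c} then f t else 0)"
    by (rule integral_spike[where S = "{c}"]) auto
  also have "\<dots> = integral ({a..c} \<inter> {u..T}) f" by (rule integral_restrict_Int)
  also have "{a..c} \<inter> {u..T} = {a..c}" using assms by auto
  finally show ?thesis .
qed

lemma card_square_le_sum_ranks:
  fixes a :: "'b \<Rightarrow> real"
  assumes "finite L"
  shows "(real (card L))\<^sup>2 \<le> 2 * (\<Sum>j\<in>L. real (card {j' \<in> L. a j' \<le> a j}))"
proof -
  have c: "real (card {j' \<in> L. Q j'}) = (\<Sum>j'\<in>L. if Q j' then 1 else 0)" for Q
    using assms by (simp add: sum.If_cases Int_def)
  have "(real (card L))\<^sup>2 = (\<Sum>j\<in>L. \<Sum>j'\<in>L. 1)" by (simp add: power2_eq_square)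
  also have "\<dots> \<le> (\<Sum>j\<in>L. \<Sum>j'\<in>L. (if a j' \<le> a j then 1 else 0) + (if a j \<le> a j' then 1 else 0))"
    by (intro sum_mono) auto
  also have "\<dots> = (\<Sum>j\<in>L. \<Sum>j'\<in>L. if a j' \<le> a j then 1 else 0) + (\<Sum>j\<in>L. \<Sum>j'\<in>L. if a j \<le> a j' then 1 else 0)"
    by (simp add: sum.distrib)
  also have "(\<Sum>j\<in>L. \<Sum>j'\<in>L. if a j \<le> a j' then 1 else 0) = (\<Sum>j\<in>L. \<Sum>j'\<in>L. if a j' \<le> a j then 1 else (0::real))"
    by (rule sum.swap)
  finally show ?thesis unfolding c by simp
qed

lemma sum_exclusive_le:
  fixes y :: real
  assumes "finite K" "0 \<le> y" and ex: "\<And>k m. k \<in> K \<Longrightarrow> m \<in> K \<Longrightarrow> Q k \<Longrightarrow> Q m \<Longrightarrow> k = m"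
  shows "(\<Sum>k\<in>K. if Q k then y else 0) \<le> y"
proof (cases "\<exists>k\<in>K. Q k")
  case True
  then obtain k where k: "k \<in> K" "Q k" by blast
  then have "(\<Sum>m\<in>K. if Q m then y else 0) = (\<Sum>m\<in>K. if m = k then y else 0)"
    using ex by (intro sum.cong) auto
  then show ?thesis using assms k by simp
next
  case False
  then have "(\<Sum>k\<in>K. if Q k then y else 0) = 0" by (intro sum.neutral) auto
  then show ?thesis using assms by simp
qed

lemma is_schedule_item:
  assumes "valid_instance P" "is_schedule P s r" "i \<in> items P"
  shows "broadcast_item P r i"
  using assms unfolding valid_instance_def is_schedule_def by unfold_locales auto

locale equiset_run =
  fixes P :: "'i broadcast_instance" and \<sigma> :: real and w :: "nat \<Rightarrow> 'i \<Rightarrow> real \<Rightarrow> real"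
  assumes valid: "valid_instance P" and \<sigma>_pos: "0 < \<sigma>" and run: "b_equiset \<sigma> P w"
begin

abbreviation r :: "'i \<Rightarrow> real \<Rightarrow> real" where "r \<equiv> total_rate P w"
abbreviation q :: nat where "q \<equiv> num_requests P"
abbreviation a :: "nat \<Rightarrow> real" where "a \<equiv> arrival P"
abbreviation rec :: "nat \<Rightarrow> 'i \<Rightarrow> ereal"
  where "rec j i \<equiv> reception_date (broadcasts_of P r i) (a j)"

lemma finite_items: "finite (items P)" and len_pos: "i \<in> items P \<Longrightarrow> 0 < len P i"
  and request_ne: "j < q \<Longrightarrow> request P j \<noteq> {}" and request_sub: "j < q \<Longrightarrow> request P j \<subseteq> items P"
  and arrival_nonneg: "j < q \<Longrightarrow> 0 \<le> a j"
  using valid by (auto simp: valid_instance_def)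

lemma finite_request: "j < q \<Longrightarrow> finite (request P j)"
  using finite_items request_sub finite_subset by blast

lemma w_integrable:
  assumes "j < q" "i \<in> items P" "0 \<le> u"
  shows "w j i integrable_on {u..T}"
proof (cases "u \<le> T")
  case True
  have "w j i integrable_on {0..T}"
    using run assms True unfolding b_equiset_def by (meson order_trans)
  then show ?thesis by (rule integrable_on_subinterval) (use assms in auto)
qed auto

lemma run_at:
  assumes "0 \<le> t" "j < q"
  shows "\<forall>i\<in>items P. 0 \<le> w j i t \<and> (\<not> alive_item P r t j i \<longrightarrow> w j i t = 0)"
    and "j \<in> alive_requests P r t \<longrightarrow>
      (\<Sum>i\<in>request P j. w j i t) = \<sigma> / real (card (alive_requests P r t))"
  using run[unfolded b_equiset_def, THEN conjunct2, rule_format, OF assms] by auto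

lemma w_nonneg: "j < q \<Longrightarrow> i \<in> items P \<Longrightarrow> 0 \<le> t \<Longrightarrow> 0 \<le> w j i t"
  and w_dead: "j < q \<Longrightarrow> i \<in> items P \<Longrightarrow> 0 \<le> t \<Longrightarrow> \<not> alive_item P r t j i \<Longrightarrow> w j i t = 0"
  using run_at(1) by auto

lemma w_share:
  "0 \<le> t \<Longrightarrow> j \<in> alive_requests P r t \<Longrightarrow>
    (\<Sum>i\<in>request P j. w j i t) = \<sigma> / real (card (alive_requests P r t))"
  using run_at(2)[of t j] by (simp add: alive_requests_def)

lemma item: "i \<in> items P \<Longrightarrow> broadcast_item P r i"
  by unfold_locales
    (auto simp: len_pos total_rate_def[abs_def] w_nonneg intro!: sum_nonneg integrable_sum w_integrable)

lemma w_le_rate: "j < q \<Longrightarrow> i \<in> items P \<Longrightarrow> 0 \<le> t \<Longrightarrow> w j i t \<le> r i t"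
  unfolding total_rate_def by (rule member_le_sum) (auto simp: w_nonneg)

lemma finite_alive: "finite (alive_requests P r t)"
  by (simp add: alive_requests_def)

lemma rate_sum:
  assumes "0 \<le> t"
  shows "(\<Sum>i\<in>items P. r i t) = (if alive_requests P r t = {} then 0 else \<sigma>)"
proof -
  let ?R = "alive_requests P r t"
  have "(\<Sum>i\<in>items P. r i t) = (\<Sum>j<q. \<Sum>i\<in>items P. w j i t)"
    unfolding total_rate_def by (rule sum.swap)
  also have "\<dots> = (\<Sum>j<q. if j \<in> ?R then \<sigma> / real (card ?R) else 0)"
  proof (intro sum.cong refl)
    fix j assume "j \<in> {..<q}"
    then have j: "j < q" by simp
    have "(\<Sum>i\<in>items P. w j i t) = (\<Sum>i\<in>request P j. w j i t)"
      using j assms request_sub[OF j] w_dead[OF j]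
      by (intro sum.mono_neutral_right finite_items) (auto simp: alive_item_def)
    also have "\<dots> = (if j \<in> ?R then \<sigma> / real (card ?R) else 0)"
    proof (cases "j \<in> ?R")
      case False
      then have "w j i t = 0" if "i \<in> request P j" for i
        using w_dead[OF j] that request_sub[OF j] assms j by (auto simp: alive_requests_def)
      then show ?thesis using False by simp
    qed (use w_share assms in auto)
    finally show "(\<Sum>i\<in>items P. w j i t) = (if j \<in> ?R then \<sigma> / real (card ?R) else 0)" .
  qed
  also have "\<dots> = (\<Sum>j\<in>?R. \<sigma> / real (card ?R))"
    by (intro sum.mono_neutral_cong_right) (auto simp: alive_requests_def)
  also have "\<dots> = (if ?R = {} then 0 else \<sigma>)" using finite_alive by simp
  finally show ?thesis .
qed

lemma rate_nonneg: "i \<in> items P \<Longrightarrow> 0 \<le> t \<Longrightarrow> 0 \<le> r i t"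
  using broadcast_item.rate_nonneg[OF item] .

lemma schedule: "is_schedule P \<sigma> r"
proof -
  have s: "(\<Sum>i\<in>items P. r i t) \<le> \<sigma>" if "0 \<le> t" for t using rate_sum[OF that] \<sigma>_pos by simp
  have "r i t \<le> \<sigma>" if "i \<in> items P" "0 \<le> t" for i t
    by (rule order_trans[OF member_le_sum[OF that(1), of "\<lambda>i. r i t"] s[OF that(2)]])
      (auto simp: rate_nonneg that finite_items)
  then show ?thesis unfolding is_schedule_def
    using s rate_nonneg broadcast_item.rate_integrable[OF item] by auto
qed

lemma integral_rate:
  "i \<in> items P \<Longrightarrow> 0 \<le> u \<Longrightarrow> u \<le> T \<Longrightarrow>
     integral {u..T} (r i) = broadcast_item.vol r i T - broadcast_item.vol r i u"
  using broadcast_item.vol_diff[OF item] .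

lemma integral_w_le:
  assumes j: "j < q" and i: "i \<in> items P" and "0 \<le> T"
  shows "integral {0..T} (w j i) \<le> 2 * len P i"
proof -
  interpret I: broadcast_item P r i using item[OF i] .
  have 1: "integral {0..T} (w j i) = integral {0..T} (\<lambda>t. if t \<in> {a j..} then w j i t else 0)"
    using w_dead[OF j i] by (intro integral_cong) (auto simp: alive_item_def)
  have Int: "{a j..} \<inter> {0..T} = {a j..T}" using arrival_nonneg[OF j] by auto
  have 2: "integral {0..T} (w j i) = integral {a j..T} (w j i)"
    unfolding 1 integral_restrict_Int Int ..
  show ?thesis
  proof (cases "a j \<le> T")
    case True
    let ?A = "\<lambda>t. ereal t < rec j i"
    have b: "integral {a j..t} (r i) \<le> 2 * len P i" if "a j \<le> t" "t \<le> T" "?A t" for t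
      using I.vol_before_reception[of "a j" "a j" t] I.vol_diff[of "a j" t] arrival_nonneg[OF j] that by auto
    have dn: "?A s" if "s \<le> t" "?A t" for s t using that le_less_trans[of "ereal s" "ereal t"] by simp
    note D = integral_down_closed_le[OF True I.rate_integrable_sub[OF arrival_nonneg[OF j]], of ?A "2 * len P i"]
    have "integral {a j..T} (w j i) \<le> integral {a j..T} (\<lambda>t. if ?A t then r i t else 0)"
    proof (rule integral_le)
      show "w j i integrable_on {a j..T}" using w_integrable[OF j i] arrival_nonneg[OF j] by auto
      show "(\<lambda>t. if ?A t then r i t else 0) integrable_on {a j..T}"
        by (rule D(1)) (use b dn I.len_pos in auto)
      show "w j i t \<le> (if ?A t then r i t else 0)" if "t \<in> {a j..T}" for t
        using that w_le_rate[OF j i, of t] w_dead[OF j i, of t] arrival_nonneg[OF j] by (auto simp: alive_item_def)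
    qed
    also have "\<dots> \<le> 2 * len P i" by (rule D(2)) (use b dn I.len_pos in auto)
    finally show ?thesis using 2 by simp
  qed (use 2 I.len_pos in auto)
qed

lemma vol_bound:
  assumes i: "i \<in> items P" and "0 \<le> T"
  shows "broadcast_item.vol r i T \<le> 2 * real q * len P i"
proof -
  interpret I: broadcast_item P r i using item[OF i] .
  have "I.vol T = integral {0..T} (\<lambda>t. \<Sum>j<q. w j i t)"
    unfolding I.vol_def total_rate_def ..
  also have "\<dots> = (\<Sum>j<q. integral {0..T} (w j i))"
    by (intro integral_sum) (auto intro: w_integrable i)
  also have "\<dots> \<le> (\<Sum>j<q. 2 * len P i)" by (intro sum_mono integral_w_le i) (use assms in auto)
  finally show ?thesis by simp
qed

lemma reception_finite:
  assumes j: "j < q" and i: "i \<in> request P j"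
  shows "rec j i \<noteq> \<infinity>"
proof
  assume inf: "rec j i = \<infinity>"
  have aj: "0 \<le> a j" using arrival_nonneg[OF j] .
  define V where "V = (\<Sum>i\<in>items P. 2 * real q * len P i)"
  have V0: "0 \<le> V" unfolding V_def using len_pos by (intro sum_nonneg mult_nonneg_nonneg) (auto intro: less_imp_le)
  define T where "T = a j + V / \<sigma> + 1"
  have T: "a j \<le> T" "0 \<le> T" unfolding T_def using V0 \<sigma>_pos aj by auto
  have "\<sigma> * (T - a j) = integral {a j..T} (\<lambda>t. \<sigma>)" using T by simp
  also have "\<dots> = integral {a j..T} (\<lambda>t. \<Sum>i\<in>items P. r i t)"
  proof (rule integral_cong)
    fix t assume t: "t \<in> {a j..T}"
    then have "j \<in> alive_requests P r t" using j i inf by (auto simp: alive_requests_def alive_item_def)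
    then show "\<sigma> = (\<Sum>i\<in>items P. r i t)" using rate_sum[of t] t aj by auto
  qed
  also have "\<dots> = (\<Sum>i\<in>items P. integral {a j..T} (r i))"
    by (intro integral_sum) (auto simp: finite_items aj intro: broadcast_item.rate_integrable_sub[OF item])
  also have "\<dots> \<le> V" unfolding V_def
  proof (rule sum_mono)
    fix i assume i: "i \<in> items P"
    show "integral {a j..T} (r i) \<le> 2 * real q * len P i"
      using vol_bound[OF i T(2)] integral_rate[OF i aj T(1)] broadcast_item.vol_nonneg[OF item[OF i] aj] by linarith
  qed
  finally have "\<sigma> * (V / \<sigma> + 1) \<le> V" by (simp add: T_def)
  then show False using \<sigma>_pos by (simp add: algebra_simps)
qed

lemma finite_released: "finite (released_copies P r)"
proof (rule finite_subset)
  show "released_copies P r \<subseteq> items P \<times> {..2 * q}"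
  proof clarify
    fix i k assume "(i, k) \<in> released_copies P r"
    then have i: "i \<in> items P" "completion_date P r i k \<noteq> \<infinity>" by (auto simp: released_copies_def)
    interpret I: broadcast_item P r i using item[OF i(1)] .
    obtain c where "0 \<le> c" "I.vol c = real k * len P i" by (rule I.completion_finite[OF i(2)])
    then have "real k * len P i \<le> 2 * real q * len P i" using vol_bound[OF i(1), of c] by simp
    then have "real k \<le> 2 * real q" using I.len_pos by simp
    then show "i \<in> items P \<and> k \<in> {..2 * q}" using i by simp
  qed
qed (use finite_items in auto)

definition ctime :: "nat \<Rightarrow> real" where
  "ctime j = real_of_ereal (request_completion P (broadcasts_of P r) j)"

lemma request_completion_eq:
  assumes j: "j < q"
  shows "request_completion P (broadcasts_of P r) j = ereal (ctime j)"
    and "a j \<le> ctime j"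
proof -
  let ?M = "request_completion P (broadcasts_of P r) j"
  have "?M \<in> (\<lambda>i. rec j i) ` request P j"
    unfolding request_completion_def
    by (rule Max_in) (use finite_request[OF j] request_ne[OF j] in auto)
  then obtain i where i: "i \<in> request P j" "?M = rec j i" by auto
  have "ereal (a j) \<le> ?M" unfolding i(2)
    using broadcast_item.reception_ge[OF item] request_sub[OF j] i by auto
  moreover have "?M \<noteq> \<infinity>" using i reception_finite[OF j] by simp
  ultimately obtain m where "?M = ereal m" "a j \<le> m" by (cases ?M) auto
  then show "?M = ereal (ctime j)" "a j \<le> ctime j" by (simp_all add: ctime_def)
qed

lemma alive_iff: "j \<in> alive_requests P r t \<longleftrightarrow> j < q \<and> a j \<le> t \<and> t < ctime j"
proof (cases "j < q")
  case j: True
  have "ereal t < request_completion P (broadcasts_of P r) j \<longleftrightarrow> (\<exists>i\<in>request P j. ereal t < rec j i)"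
    unfolding request_completion_def using finite_request[OF j] request_ne[OF j] by (subst Max_gr_iff) auto
  then show ?thesis using j request_completion_eq[OF j] by (auto simp: alive_requests_def alive_item_def)
qed (auto simp: alive_requests_def)

end

section \<open>Competitiveness of B-EquiSet\<close>

lemma sum_le_integral_disjoint:
  fixes g :: "real \<Rightarrow> real"
  assumes "finite K" and g: "g integrable_on {u..T}" "\<And>t. t \<in> {u..T} \<Longrightarrow> 0 \<le> g t"
    and ex: "\<And>k m t. k \<in> K \<Longrightarrow> m \<in> K \<Longrightarrow> k \<noteq> m \<Longrightarrow> \<not> (b k \<le> t \<and> t < c k \<and> b m \<le> t \<and> t < c m)"
  shows "(\<Sum>k\<in>K. integral {u..T} (\<lambda>t. if b k \<le> t \<and> t < c k then g t else 0)) \<le> integral {u..T} g"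
proof -
  have "(\<Sum>k\<in>K. integral {u..T} (\<lambda>t. if b k \<le> t \<and> t < c k then g t else 0))
      = integral {u..T} (\<lambda>t. \<Sum>k\<in>K. if b k \<le> t \<and> t < c k then g t else 0)"
    by (intro integral_sum[symmetric] assms integrable_if_between)
  also have "\<dots> \<le> integral {u..T} g"
    by (intro integral_le integrable_sum sum_exclusive_le integrable_if_between assms) (use ex in blast)+
  finally show ?thesis .
qed

context equiset_run
begin

definition num_alive :: "real \<Rightarrow> real" where
  "num_alive t = (\<Sum>j<q. if a j \<le> t \<and> t < ctime j then 1 else 0)"

definition arrival_rank :: "nat \<Rightarrow> real \<Rightarrow> real" where
  "arrival_rank j t = (\<Sum>j'\<in>{j'. j' < q \<and> a j' \<le> a j}. if a j' \<le> t \<and> t < ctime j' then 1 else 0)"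

lemma num_alive_eq: "num_alive t = real (card (alive_requests P r t))"
proof -
  have "alive_requests P r t = {..<q} \<inter> {j. a j \<le> t \<and> t < ctime j}" using alive_iff by auto
  then show ?thesis unfolding num_alive_def by (simp add: sum.If_cases)
qed

lemma rank_eq: "arrival_rank j t = real (card {j' \<in> alive_requests P r t. a j' \<le> a j})"
proof -
  have "{j' \<in> alive_requests P r t. a j' \<le> a j} = {j'. j' < q \<and> a j' \<le> a j} \<inter> {j. a j \<le> t \<and> t < ctime j}"
    using alive_iff by auto
  then show ?thesis unfolding arrival_rank_def by (simp add: sum.If_cases)
qed

lemma rank_times_integrable:
  assumes "f integrable_on {u..T}"
  shows "(\<lambda>t. arrival_rank j t * f t) integrable_on {u..T}"
proof -
  have "(\<lambda>t. \<Sum>j'\<in>{j'. j' < q \<and> a j' \<le> a j}. if a j' \<le> t \<and> t < ctime j' then f t else 0) integrable_on {u..T}"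
    by (intro integrable_sum integrable_if_between assms) auto
  then show ?thesis unfolding arrival_rank_def sum_distrib_right by (rule integrable_eq) (auto intro!: sum.cong)
qed

lemma num_alive_times_integrable:
  assumes "f integrable_on {u..T}"
  shows "(\<lambda>t. num_alive t * f t) integrable_on {u..T}"
proof -
  have "(\<lambda>t. \<Sum>j<q. if a j \<le> t \<and> t < ctime j then f t else 0) integrable_on {u..T}"
    by (intro integrable_sum integrable_if_between assms) auto
  then show ?thesis unfolding num_alive_def sum_distrib_right by (rule integrable_eq) (auto intro!: sum.cong)
qed

lemma num_alive_nonneg: "0 \<le> num_alive t"
  unfolding num_alive_eq by simp

text \<open>A request is late at \<open>t\<close> if the optimum has completed it (at \<open>d j \<le> t\<close>).  The late requests,
  weighted by their ranks, receive much bandwidth unless the optimum has many alive requests.\<close>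

lemma late_requests_share:
  fixes d :: "nat \<Rightarrow> real"
  assumes t: "0 \<le> t"
  shows "\<sigma> * (num_alive t - 2 * (\<Sum>j<q. if a j \<le> t \<and> t < d j then 1 else 0))
    \<le> 2 * (\<Sum>j<q. \<Sum>i\<in>request P j. if d j \<le> t then arrival_rank j t * w j i t else 0)"
proof -
  let ?R = "alive_requests P r t"
  define L where "L = {j \<in> ?R. d j \<le> t}"
  define m where "m = (\<Sum>j<q. if a j \<le> t \<and> t < d j then 1 else (0::real))"
  define n where "n = num_alive t"
  define l where "l = real (card L)"
  have n: "n = real (card ?R)" by (simp add: n_def num_alive_eq)
  have m: "m = real (card {j. j < q \<and> a j \<le> t \<and> t < d j})"
    unfolding m_def by (simp add: sum.If_cases Int_def)
  have m0: "0 \<le> m" unfolding m by simp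
  have fL: "finite L" unfolding L_def using finite_alive by simp
  have "n \<le> l + m"
  proof -
    have "card ?R \<le> card (L \<union> {j. j < q \<and> a j \<le> t \<and> t < d j})"
      by (intro card_mono) (use fL in \<open>auto simp: L_def alive_iff\<close>)
    also have "\<dots> \<le> card L + card {j. j < q \<and> a j \<le> t \<and> t < d j}" by (rule card_Un_le)
    finally show ?thesis unfolding n l_def m by linarith
  qed
  have W: "(\<Sum>i\<in>request P j. if d j \<le> t then arrival_rank j t * w j i t else 0)
      = (if j \<in> L then arrival_rank j t * (\<sigma> / n) else 0)" if j: "j < q" for j
  proof (cases "j \<in> ?R")
    case True
    then show ?thesis using w_share[OF t True] by (auto simp: L_def n sum_distrib_left[symmetric])
  next
    case False
    then have "w j i t = 0" if "i \<in> request P j" for i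
      using w_dead[OF j _ t, of i] request_sub[OF j] j that by (auto simp: alive_requests_def)
    then have "(\<Sum>i\<in>request P j. if d j \<le> t then arrival_rank j t * w j i t else 0) = 0"
      by (intro sum.neutral) auto
    then show ?thesis using False by (simp add: L_def)
  qed
  have "(\<Sum>j<q. \<Sum>i\<in>request P j. if d j \<le> t then arrival_rank j t * w j i t else 0)
      = (\<Sum>j<q. if j \<in> L then arrival_rank j t * (\<sigma> / n) else 0)" by (intro sum.cong) (auto simp: W)
  also have "\<dots> = (\<Sum>j\<in>L. arrival_rank j t * (\<sigma> / n))"
    by (intro sum.mono_neutral_cong_right) (auto simp: L_def alive_iff)
  also have "\<dots> = (\<sigma> / n) * (\<Sum>j\<in>L. arrival_rank j t)" by (simp add: sum_distrib_left mult.commute)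
  finally have eq: "(\<Sum>j<q. \<Sum>i\<in>request P j. if d j \<le> t then arrival_rank j t * w j i t else 0)
      = (\<sigma> / n) * (\<Sum>j\<in>L. arrival_rank j t)" .
  have "l\<^sup>2 \<le> 2 * (\<Sum>j\<in>L. real (card {j' \<in> L. a j' \<le> a j}))"
    unfolding l_def by (rule card_square_le_sum_ranks[OF fL])
  also have "\<dots> \<le> 2 * (\<Sum>j\<in>L. arrival_rank j t)" unfolding rank_eq
    using finite_alive by (intro mult_left_mono sum_mono of_nat_mono card_mono) (auto simp: L_def)
  finally have sq: "l\<^sup>2 \<le> 2 * (\<Sum>j\<in>L. arrival_rank j t)" .
  show ?thesis
  proof (cases "n = 0")
    case True
    then have "\<sigma> * (n - 2 * m) \<le> 0" using m0 \<sigma>_pos by (simp add: mult_le_0_iff)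
    then show ?thesis using True unfolding eq m_def n_def by simp
  next
    case False
    then have n0: "0 < n" unfolding n by simp
    have "(n - 2 * m) * n \<le> l\<^sup>2"
    proof (cases "m \<le> n")
      case True
      then have "(n - m)\<^sup>2 \<le> l\<^sup>2" using \<open>n \<le> l + m\<close> by (intro power_mono) auto
      moreover have "(n - m)\<^sup>2 = (n - 2 * m) * n + m\<^sup>2" by (simp add: power2_eq_square algebra_simps)
      ultimately show ?thesis using zero_le_power2[of m] by linarith
    next
      case False
      then have "(n - 2 * m) * n \<le> 0" using n0 by (intro mult_nonpos_nonneg) auto
      then show ?thesis using zero_le_power2[of l] by linarith
    qed
    then have "n - 2 * m \<le> 2 * (\<Sum>j\<in>L. arrival_rank j t) / n" using sq n0 by (simp add: field_simps)
    then have "\<sigma> * (n - 2 * m) \<le> \<sigma> * (2 * (\<Sum>j\<in>L. arrival_rank j t) / n)"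
      using \<sigma>_pos by (intro mult_left_mono) auto
    then show ?thesis unfolding eq m_def n_def by (simp add: field_simps)
  qed
qed

text \<open>All requests of \<open>J\<close> arrive before the broadcast \<open>[B, C)\<close> of \<open>i\<close> in the optimum and are late
  only after it.  The requests counted by their ranks at \<open>t \<ge> C\<close> were all alive during
  \<open>[B, C)\<close>, so the bandwidth they get is paid by this broadcast.\<close>

lemma charge_broadcast:
  fixes v :: "real \<Rightarrow> real" and d :: "nat \<Rightarrow> real"
  assumes i: "i \<in> items P" and J: "J \<subseteq> {..<q}"
    and aB: "\<And>j. j \<in> J \<Longrightarrow> a j \<le> B" and Cd: "\<And>j. j \<in> J \<Longrightarrow> C \<le> d j"
    and BC: "0 \<le> B" "B \<le> C" "C \<le> T"
    and v: "v integrable_on {0..T}" "\<And>t. t \<in> {0..T} \<Longrightarrow> 0 \<le> v t" "integral {B..C} v = len P i"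
  shows "(\<Sum>j\<in>J. integral {0..T} (\<lambda>t. if d j \<le> t then arrival_rank j t * w j i t else 0))
    \<le> 2 * integral {0..T} (\<lambda>t. if B \<le> t \<and> t < C then num_alive t * v t else 0)"
proof -
  interpret I: broadcast_item P r i using item[OF i] .
  have fJ: "finite J" using J finite_subset by blast
  define S where "S = {j. j < q \<and> a j \<le> B \<and> C < ctime j}"
  define M where "M = real (card S)"
  have M0: "0 \<le> M" and fS: "finite S" by (auto simp: M_def S_def)
  have rankM: "arrival_rank j t \<le> M" if "j \<in> J" "C \<le> t" for j t
    unfolding rank_eq M_def using fS aB[OF that(1)] that
    by (intro of_nat_mono card_mono) (auto simp: S_def alive_iff)
  have aliveM: "M \<le> num_alive t" if "B \<le> t" "t < C" for t
    unfolding num_alive_eq M_def using finite_alive that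
    by (intro of_nat_mono card_mono) (auto simp: S_def alive_iff)
  define A where "A t \<longleftrightarrow> (\<exists>j\<in>J. ereal t < rec j i)" for t
  have dn: "A s" if "s \<le> t" "A t" for s t
    using that le_less_trans[of "ereal s" "ereal t"] unfolding A_def by auto
  have bd: "integral {C..t} (r i) \<le> 2 * len P i" if "C \<le> t" "A t" for t
  proof -
    obtain j where j: "j \<in> J" "ereal t < rec j i" using \<open>A t\<close> A_def by auto
    then have "0 \<le> a j" using arrival_nonneg J by auto
    then have "I.vol t - I.vol C < 2 * len P i"
      using I.vol_before_reception[of "a j" C t] aB[OF j(1)] BC j that by auto
    then show ?thesis using I.vol_diff[of C t] BC that by simp
  qed
  note D = integral_down_closed_le[OF BC(3) I.rate_integrable_sub, of A "2 * len P i"]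
  have D1: "(\<lambda>t. if A t then r i t else 0) integrable_on {C..T}"
    by (rule D(1)) (use BC dn bd I.len_pos in auto)
  have D2: "integral {C..T} (\<lambda>t. if A t then r i t else 0) \<le> 2 * len P i"
    by (rule D(2)) (use BC dn bd I.len_pos in auto)
  have wi: "w j i integrable_on {u..T}" if "j \<in> J" "0 \<le> u" for j u
    using w_integrable[OF _ i] that J by auto
  have Int: "{C..} \<inter> {0..T} = {C..T}" using BC by auto
  have "(\<Sum>j\<in>J. integral {0..T} (\<lambda>t. if d j \<le> t then arrival_rank j t * w j i t else 0))
      = (\<Sum>j\<in>J. integral {0..T} (\<lambda>t. if t \<in> {C..} then if d j \<le> t then arrival_rank j t * w j i t else 0 else 0))"
    using Cd by (intro sum.cong integral_cong refl) force
  also have "\<dots> = (\<Sum>j\<in>J. integral {C..T} (\<lambda>t. if d j \<le> t then arrival_rank j t * w j i t else 0))"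
    unfolding integral_restrict_Int Int ..
  also have "\<dots> = integral {C..T} (\<lambda>t. \<Sum>j\<in>J. if d j \<le> t then arrival_rank j t * w j i t else 0)"
    using BC by (intro integral_sum[symmetric] fJ integrable_if_ge rank_times_integrable wi) auto
  also have "\<dots> \<le> integral {C..T} (\<lambda>t. M * (if A t then r i t else 0))"
  proof (rule integral_le)
    show "(\<lambda>t. \<Sum>j\<in>J. if d j \<le> t then arrival_rank j t * w j i t else 0) integrable_on {C..T}"
      using BC by (intro integrable_sum fJ integrable_if_ge rank_times_integrable wi) auto
    show "(\<lambda>t. M * (if A t then r i t else 0)) integrable_on {C..T}"
      using integrable_on_cmult_left[OF D1, of M] by simp
    fix t assume t: "t \<in> {C..T}"
    have w0: "0 \<le> w j i t" if "j < q" for j using w_nonneg[OF that i] t BC by auto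
    have "(if d j \<le> t then arrival_rank j t * w j i t else 0) \<le> M * (if A t then w j i t else 0)" if j: "j \<in> J" for j
    proof (cases "A t")
      case True
      have jq: "j < q" using j J by auto
      have "arrival_rank j t * w j i t \<le> M * w j i t" using rankM[OF j] w0[OF jq] t by (intro mult_right_mono) auto
      then show ?thesis using True M0 w0[OF jq] by simp
    next
      case False
      then have "w j i t = 0" using w_dead[OF _ i, of j t] j J t BC by (auto simp: alive_item_def A_def)
      then show ?thesis by simp
    qed
    then have "(\<Sum>j\<in>J. if d j \<le> t then arrival_rank j t * w j i t else 0) \<le> (\<Sum>j\<in>J. M * (if A t then w j i t else 0))"
      by (rule sum_mono)
    also have "\<dots> \<le> (\<Sum>j<q. M * (if A t then w j i t else 0))"
      by (rule sum_mono2) (use J M0 w0 in auto)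
    also have "\<dots> = M * (if A t then r i t else 0)" by (simp add: total_rate_def sum_distrib_left)
    finally show "(\<Sum>j\<in>J. if d j \<le> t then arrival_rank j t * w j i t else 0) \<le> M * (if A t then r i t else 0)" .
  qed
  also have "\<dots> = M * integral {C..T} (\<lambda>t. if A t then r i t else 0)" by simp
  also have "\<dots> \<le> M * (2 * len P i)" using D2 M0 by (intro mult_left_mono)
  also have "\<dots> = 2 * (M * integral {B..C} v)" using v by simp
  also have "M * integral {B..C} v = integral {0..T} (\<lambda>t. if B \<le> t \<and> t < C then M * v t else 0)"
    using BC by (simp add: integral_if_between)
  also have "\<dots> \<le> integral {0..T} (\<lambda>t. if B \<le> t \<and> t < C then num_alive t * v t else 0)"
  proof (rule integral_le)
    show "(\<lambda>t. if B \<le> t \<and> t < C then M * v t else 0) integrable_on {0..T}"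
      using integrable_on_cmult_left[OF v(1), of M] by (intro integrable_if_between) simp
    show "(\<lambda>t. if B \<le> t \<and> t < C then num_alive t * v t else 0) integrable_on {0..T}"
      by (intro integrable_if_between num_alive_times_integrable v)
  qed (use aliveM v(2) in \<open>auto intro!: mult_right_mono\<close>)
  finally show ?thesis by simp
qed

lemma flow_competitive:
  fixes d :: "nat \<Rightarrow> real"
  assumes opt: "is_schedule P 1 v"
    and d: "\<And>j. j < q \<Longrightarrow> request_completion P (broadcasts_of P v) j = ereal (d j)"
  shows "(\<sigma> - 4) * (\<Sum>j<q. ctime j - a j) \<le> 2 * \<sigma> * (\<Sum>j<q. d j - a j)"
proof -
  define F D where "F = (\<Sum>j<q. ctime j - a j)" and "D = (\<Sum>j<q. d j - a j)"
  have item': "broadcast_item P v i" if "i \<in> items P" for i using is_schedule_item[OF valid opt that] .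
  define ks where "ks j i = (SOME k. 1 \<le> k \<and> ereal (a j) \<le> begin_date P v i k \<and>
    completion_date P v i k = reception_date (broadcasts_of P v i) (a j))" for j i
  have rec_le: "reception_date (broadcasts_of P v i) (a j) \<le> ereal (d j)" if "j < q" "i \<in> request P j" for i j
    unfolding d[OF that(1), symmetric] request_completion_def
    using finite_request[OF that(1)] that by (intro Max_ge) auto
  have ks: "1 \<le> ks j i" "ereal (a j) \<le> begin_date P v i (ks j i)" "completion_date P v i (ks j i) \<le> ereal (d j)"
    if "j < q" "i \<in> request P j" for j i
  proof -
    have i: "i \<in> items P" using that request_sub by auto
    have "reception_date (broadcasts_of P v i) (a j) \<noteq> \<infinity>" using rec_le[OF that] by auto
    then have "\<exists>k. 1 \<le> k \<and> ereal (a j) \<le> begin_date P v i k \<and>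
      completion_date P v i k = reception_date (broadcasts_of P v i) (a j)"
      by (rule broadcast_item.reception_attained[OF item'[OF i]]) (use arrival_nonneg that in auto)
    from someI_ex[OF this] show "1 \<le> ks j i" "ereal (a j) \<le> begin_date P v i (ks j i)"
      "completion_date P v i (ks j i) \<le> ereal (d j)" using rec_le[OF that] unfolding ks_def by auto
  qed
  have ad: "a j \<le> d j" if j: "j < q" for j
  proof -
    obtain i where i: "i \<in> request P j" using request_ne[OF j] by auto
    then have "ereal (a j) \<le> reception_date (broadcasts_of P v i) (a j)"
      using broadcast_item.reception_ge[OF item'] request_sub[OF j] by auto
    also have "\<dots> \<le> ereal (d j)" by (rule rec_le[OF j i])
    finally show ?thesis by simp
  qed
  define T where "T = (\<Sum>j<q. ctime j + d j)"
  have cd0: "0 \<le> ctime j" "0 \<le> d j" if "j < q" for j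
    using that ad[OF that] arrival_nonneg[OF that] request_completion_eq(2)[OF that] by linarith+
  have T: "ctime j \<le> T" "d j \<le> T" if "j < q" for j
  proof -
    have "ctime j + d j \<le> T" unfolding T_def using that cd0 by (intro member_le_sum) auto
    then show "ctime j \<le> T" "d j \<le> T" using cd0[OF that] by linarith+
  qed
  have T0: "0 \<le> T" unfolding T_def using cd0 by (intro sum_nonneg) auto
  have cnt: "integral {0..T} (\<lambda>t. if a j \<le> t \<and> t < e then 1 else 0) = e - a j"
    if "j < q" "a j \<le> e" "e \<le> T" for j and e :: real
    using that arrival_nonneg by (subst integral_if_between) auto
  have one: "(\<lambda>_. 1::real) integrable_on {0..T}" by (rule integrable_const_ivl)
  have intF: "num_alive integrable_on {0..T}" "integral {0..T} num_alive = F"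
  proof -
    show "num_alive integrable_on {0..T}"
      using num_alive_times_integrable[OF one] by simp
    have "integral {0..T} num_alive = (\<Sum>j<q. integral {0..T} (\<lambda>t. if a j \<le> t \<and> t < ctime j then 1 else 0))"
      unfolding num_alive_def[abs_def] by (intro integral_sum integrable_if_between one) auto
    also have "\<dots> = F" unfolding F_def using T request_completion_eq(2) by (intro sum.cong) (auto simp: cnt)
    finally show "integral {0..T} num_alive = F" .
  qed
  let ?o = "\<lambda>t. (\<Sum>j<q. if a j \<le> t \<and> t < d j then 1 else (0::real))"
  have intD: "?o integrable_on {0..T}" "integral {0..T} ?o = D"
  proof -
    show "?o integrable_on {0..T}" by (intro integrable_sum integrable_if_between one) auto
    have "integral {0..T} ?o = (\<Sum>j<q. integral {0..T} (\<lambda>t. if a j \<le> t \<and> t < d j then 1 else 0))"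
      by (intro integral_sum integrable_if_between one) auto
    also have "\<dots> = D" unfolding D_def using T ad by (intro sum.cong) (auto simp: cnt)
    finally show "integral {0..T} ?o = D" .
  qed
  define h where "h j i t = (if d j \<le> t then arrival_rank j t * w j i t else 0)" for j i t
  have hint: "h j i integrable_on {0..T}" if "j < q" "i \<in> items P" for j i
    unfolding h_def[abs_def] by (intro integrable_if_ge rank_times_integrable w_integrable that) simp
  have "\<sigma> * (F - 2 * D) = integral {0..T} (\<lambda>t. \<sigma> * (num_alive t - 2 * ?o t))"
    using integral_diff[OF intF(1) integrable_on_cmult_left[OF intD(1), of 2]] intF(2) intD(2) by simp
  also have "\<dots> \<le> integral {0..T} (\<lambda>t. 2 * (\<Sum>j<q. \<Sum>i\<in>request P j. h j i t))"
  proof (rule integral_le)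
    have "(\<lambda>t. num_alive t - 2 * ?o t) integrable_on {0..T}"
      using integrable_diff[OF intF(1) integrable_on_cmult_left[OF intD(1), of 2]] by simp
    from integrable_on_cmult_left[OF this, of \<sigma>]
    show "(\<lambda>t. \<sigma> * (num_alive t - 2 * ?o t)) integrable_on {0..T}" by simp
    have "(\<lambda>t. \<Sum>j<q. \<Sum>i\<in>request P j. h j i t) integrable_on {0..T}"
      using finite_request request_sub by (intro integrable_sum hint) auto
    from integrable_on_cmult_left[OF this, of 2]
    show "(\<lambda>t. 2 * (\<Sum>j<q. \<Sum>i\<in>request P j. h j i t)) integrable_on {0..T}" by simp
    show "\<sigma> * (num_alive t - 2 * ?o t) \<le> 2 * (\<Sum>j<q. \<Sum>i\<in>request P j. h j i t)" if "t \<in> {0..T}" for t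
      unfolding h_def using late_requests_share[of t d] that by auto
  qed
  also have "\<dots> = 2 * (\<Sum>j<q. integral {0..T} (\<lambda>t. \<Sum>i\<in>request P j. h j i t))"
    using finite_request request_sub by (subst integral_mult_right, subst integral_sum) (auto intro!: integrable_sum hint)
  also have "\<dots> = 2 * (\<Sum>j<q. \<Sum>i\<in>request P j. integral {0..T} (h j i))"
    using finite_request request_sub by (intro arg_cong[where f = "\<lambda>x. 2 * x"] sum.cong refl integral_sum) (auto intro!: hint)
  also have "(\<Sum>j<q. \<Sum>i\<in>request P j. integral {0..T} (h j i))
      = (\<Sum>i\<in>items P. \<Sum>j\<in>{j. j < q \<and> i \<in> request P j}. integral {0..T} (h j i))"
  proof -
    have "(\<Sum>j<q. \<Sum>i\<in>request P j. integral {0..T} (h j i))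
        = (\<Sum>j<q. \<Sum>i\<in>{i \<in> items P. i \<in> request P j}. integral {0..T} (h j i))"
      using request_sub by (intro sum.cong refl) auto
    also have "\<dots> = (\<Sum>i\<in>items P. \<Sum>j\<in>{j \<in> {..<q}. i \<in> request P j}. integral {0..T} (h j i))"
      by (intro sum.swap_restrict finite_items) auto
    finally show ?thesis by simp
  qed
  also have "\<dots> \<le> (\<Sum>i\<in>items P. 2 * integral {0..T} (\<lambda>t. num_alive t * v i t))"
  proof (rule sum_mono)
    fix i assume i: "i \<in> items P"
    interpret V: broadcast_item P v i using item'[OF i] .
    define J where "J = {j. j < q \<and> i \<in> request P j}"
    define K where "K = (\<lambda>j. ks j i) ` J"
    have fin: "finite J" "finite K" by (auto simp: J_def K_def)
    define b c where "b k = real_of_ereal (begin_date P v i k)"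
      and "c k = real_of_ereal (completion_date P v i k)" for k
    have Kint: "begin_date P v i k = ereal (b k)" "completion_date P v i k = ereal (c k)" "0 \<le> b k" "b k < c k"
      "integral {b k..c k} (v i) = len P i" "c k \<le> T" if "k \<in> K" for k
    proof -
      obtain j where j: "j \<in> J" "k = ks j i" using \<open>k \<in> K\<close> by (auto simp: K_def)
      then have k: "1 \<le> k" "completion_date P v i k \<le> ereal (d j)" using ks[of j i] by (auto simp: J_def)
      then have "completion_date P v i k \<noteq> \<infinity>" by auto
      from V.broadcast_interval[OF k(1) this] obtain b' c' where
        *: "begin_date P v i k = ereal b'" "completion_date P v i k = ereal c'"
           "0 \<le> b'" "b' < c'" "V.vol b' = real (k - 1) * len P i" "V.vol c' = real k * len P i" .
      have "b k = b'" "c k = c'" using * by (auto simp: b_def c_def)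
      moreover have "real k * len P i - real (k - 1) * len P i = len P i"
        using k(1) by (simp add: algebra_simps of_nat_diff)
      ultimately show "begin_date P v i k = ereal (b k)" "completion_date P v i k = ereal (c k)" "0 \<le> b k" "b k < c k"
        "integral {b k..c k} (v i) = len P i" "c k \<le> T"
        using * V.vol_diff[of b' c'] k(2) T(2)[of j] j by (auto simp: J_def)
    qed
    have "(\<Sum>j\<in>J. integral {0..T} (h j i)) = (\<Sum>k\<in>K. \<Sum>j\<in>{j \<in> J. ks j i = k}. integral {0..T} (h j i))"
      unfolding K_def by (rule sum.image_gen[OF fin(1)])
    also have "\<dots> \<le> (\<Sum>k\<in>K. 2 * integral {0..T} (\<lambda>t. if b k \<le> t \<and> t < c k then num_alive t * v i t else 0))"
    proof (rule sum_mono)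
      fix k assume k: "k \<in> K"
      show "(\<Sum>j\<in>{j \<in> J. ks j i = k}. integral {0..T} (h j i))
        \<le> 2 * integral {0..T} (\<lambda>t. if b k \<le> t \<and> t < c k then num_alive t * v i t else 0)"
        unfolding h_def[abs_def]
      proof (rule charge_broadcast[OF i])
        show "a j \<le> b k" if "j \<in> {j \<in> J. ks j i = k}" for j
          using ks(2)[of j i] that Kint(1)[OF k] by (auto simp: J_def)
        show "c k \<le> d j" if "j \<in> {j \<in> J. ks j i = k}" for j
          using ks(3)[of j i] that Kint(2)[OF k] by (auto simp: J_def)
      qed (use Kint[OF k] V.rate_integrable[OF T0] V.rate_nonneg in \<open>auto simp: J_def\<close>)
    qed
    also have "\<dots> = 2 * (\<Sum>k\<in>K. integral {0..T} (\<lambda>t. if b k \<le> t \<and> t < c k then num_alive t * v i t else 0))"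
      by (simp add: sum_distrib_left)
    also have "\<dots> \<le> 2 * integral {0..T} (\<lambda>t. num_alive t * v i t)"
    proof (intro mult_left_mono sum_le_integral_disjoint fin)
      show "(\<lambda>t. num_alive t * v i t) integrable_on {0..T}"
        by (intro num_alive_times_integrable V.rate_integrable T0)
      have lt: "c k \<le> b m" if "k \<in> K" "m \<in> K" "k < m" for k m
        using V.completion_mono[of k "m - 1"] V.begin_ge_completion[of m] Kint[OF that(1)] Kint[OF that(2)] that(3)
        by (metis Suc_pred' bot_nat_0.not_eq_extremum diff_Suc_1 ereal_less_eq(3) less_Suc_eq_le not_less_zero order_trans)
      show "\<not> (b k \<le> t \<and> t < c k \<and> b m \<le> t \<and> t < c m)" if "k \<in> K" "m \<in> K" "k \<noteq> m" for k m t
        using lt[of k m] lt[of m k] that by (cases "k < m") auto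
    qed (use num_alive_nonneg V.rate_nonneg in auto)
    finally show "(\<Sum>j\<in>{j. j < q \<and> i \<in> request P j}. integral {0..T} (h j i))
      \<le> 2 * integral {0..T} (\<lambda>t. num_alive t * v i t)" unfolding J_def .
  qed
  also have "(\<Sum>i\<in>items P. 2 * integral {0..T} (\<lambda>t. num_alive t * v i t))
      = 2 * integral {0..T} (\<lambda>t. \<Sum>i\<in>items P. num_alive t * v i t)"
    by (subst integral_sum, unfold sum_distrib_left)
      (auto simp: finite_items T0 sum_distrib_left intro!: num_alive_times_integrable broadcast_item.rate_integrable[OF item'])
  also have "integral {0..T} (\<lambda>t. \<Sum>i\<in>items P. num_alive t * v i t) \<le> F"
    unfolding intF(2)[symmetric]
  proof (rule integral_le)
    show "(\<lambda>t. \<Sum>i\<in>items P. num_alive t * v i t) integrable_on {0..T}"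
      by (intro integrable_sum finite_items num_alive_times_integrable broadcast_item.rate_integrable[OF item'] T0)
    show "(\<Sum>i\<in>items P. num_alive t * v i t) \<le> num_alive t" if "t \<in> {0..T}" for t
      using that opt num_alive_nonneg[of t] mult_left_mono[of "\<Sum>i\<in>items P. v i t" 1 "num_alive t"]
      by (auto simp: sum_distrib_left[symmetric] is_schedule_def)
  qed (rule intF)
  finally have "\<sigma> * (F - 2 * D) \<le> 4 * F" by simp
  then show ?thesis unfolding F_def[symmetric] D_def[symmetric] by (simp add: algebra_simps)
qed

end

section \<open>Executions of B-EquiSet-Edf\<close>

locale edf_run = equiset_run P \<sigma> w
  for P :: "'i broadcast_instance" and \<sigma> :: real and w :: "nat \<Rightarrow> 'i \<Rightarrow> real \<Rightarrow> real" +
  fixes s \<delta> :: real and \<rho> :: "'i copy_rates"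
  assumes \<delta>_pos: "0 < \<delta>" and s_eq: "s = \<sigma> * (1 + \<delta>)" and edf: "edf s \<delta> P r \<rho>"
begin

abbreviation rel :: "'i \<times> nat \<Rightarrow> real" where "rel \<equiv> release P r"
abbreviation dl :: "'i \<times> nat \<Rightarrow> real" where "dl \<equiv> deadline \<delta> P r"
abbreviation copies :: "('i \<times> nat) set" where "copies \<equiv> released_copies P r"
abbreviation pend :: "real \<Rightarrow> ('i \<times> nat) set" where "pend \<equiv> pending P r \<rho>"

lemma s_pos: "0 < s"
  unfolding s_eq using \<sigma>_pos \<delta>_pos by (intro mult_pos_pos) auto

lemma copy_dates:
  assumes "(i, k) \<in> copies"
  obtains b where "begin_date P r i k = ereal b" "completion_date P r i k = ereal (rel (i, k))"
    "0 \<le> b" "b < rel (i, k)" "dl (i, k) = rel (i, k) + (rel (i, k) - b) / \<delta>" "rel (i, k) < dl (i, k)"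
proof -
  have ik: "i \<in> items P" "1 \<le> k" "completion_date P r i k \<noteq> \<infinity>"
    using assms by (auto simp: released_copies_def)
  obtain b c where bc: "begin_date P r i k = ereal b" "completion_date P r i k = ereal c" "0 \<le> b" "b < c"
    using broadcast_item.broadcast_interval[OF item[OF ik(1)] ik(2,3)] by metis
  then have rel: "rel (i, k) = c" by (simp add: release_def)
  then have "dl (i, k) = c + (c - b) / \<delta>" using bc by (simp add: deadline_def)
  then show ?thesis using that[of b] bc rel \<delta>_pos by simp
qed

lemma copy_pos: "x \<in> copies \<Longrightarrow> 0 < rel x" and rel_less_dl: "x \<in> copies \<Longrightarrow> rel x < dl x"
proof -
  assume x: "x \<in> copies"
  obtain i k where "x = (i, k)" by (cases x)
  with x obtain b where "0 \<le> b" "b < rel x" "rel x < dl x" using copy_dates[of i k] by metis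
  then show "0 < rel x" "rel x < dl x" by auto
qed

lemma copy_len_pos: "x \<in> copies \<Longrightarrow> 0 < len P (fst x)"
  using len_pos by (auto simp: released_copies_def)

lemma pend_sub: "pend t \<subseteq> copies"
  by (auto simp: pending_def)

lemma \<rho>_integrable: "0 \<le> u \<Longrightarrow> \<rho> x integrable_on {u..T}"
proof (cases "u \<le> T")
  case True
  assume "0 \<le> u"
  moreover have "\<rho> x integrable_on {0..T}" if "0 \<le> T" using edf[unfolded edf_def, THEN conjunct1, rule_format, OF that] .
  ultimately show ?thesis
    using True by (metis atLeastatMost_subset_iff integrable_on_subinterval order_refl order_trans)
qed auto

lemma edf_idle: "0 \<le> t \<Longrightarrow> pend t = {} \<Longrightarrow> \<rho> x t = 0"
  by (rule edf[unfolded edf_def, THEN conjunct2, THEN conjunct1, rule_format])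

lemma edf_busy:
  assumes "0 \<le> t" "pend t \<noteq> {}"
  obtains x where "x \<in> pend t" "\<And>y. y \<in> pend t \<Longrightarrow> dl x \<le> dl y" "\<And>y. \<rho> y t = (if y = x then s else 0)"
proof -
  from edf[unfolded edf_def, THEN conjunct2, THEN conjunct2, THEN conjunct1, rule_format, OF assms]
  obtain x where "x \<in> pend t" "\<forall>y\<in>pend t. dl x \<le> dl y" "\<rho> x t = s" "\<forall>y. y \<noteq> x \<longrightarrow> \<rho> y t = 0" by blast
  then show ?thesis using that[of x] by auto
qed

lemma edf_continue:
  assumes "0 \<le> t" "t < u" "0 < \<rho> x t" "x \<in> pend u"
    "\<And>y. y \<in> copies \<Longrightarrow> t < rel y \<Longrightarrow> rel y \<le> u \<Longrightarrow> dl x \<le> dl y"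
  shows "0 < \<rho> x u"
proof -
  have "\<not> (\<exists>y\<in>copies. t < rel y \<and> rel y \<le> u \<and> dl y < dl x)" using assms(5) by force
  then show ?thesis
    using edf[unfolded edf_def, THEN conjunct2, THEN conjunct2, THEN conjunct2, rule_format, of t u x] assms by simp
qed

lemma edf_cases:
  assumes "0 \<le> t"
  shows "\<rho> x t = 0 \<or> \<rho> x t = s \<and> x \<in> pend t"
proof (cases "pend t = {}")
  case False
  from edf_busy[OF assms this] obtain z where "z \<in> pend t" "\<And>y. \<rho> y t = (if y = z then s else 0)" by metis
  then show ?thesis by simp
qed (use edf_idle assms in simp)

lemma \<rho>_nonneg: "0 \<le> t \<Longrightarrow> 0 \<le> \<rho> x t"
  using s_pos edf_cases[of t x] by auto

lemma \<rho>_pos_pend: "0 \<le> t \<Longrightarrow> 0 < \<rho> x t \<Longrightarrow> x \<in> pend t"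
  using edf_cases[of t x] by auto

lemma one_at_a_time: "one_at_a_time \<rho>"
  unfolding one_at_a_time_def
proof (intro allI impI)
  fix t :: real and x y assume t: "0 \<le> t" and xy: "0 < \<rho> x t \<and> 0 < \<rho> y t"
  then have "pend t \<noteq> {}" using \<rho>_pos_pend by blast
  from edf_busy[OF t this] obtain z where "\<And>y. \<rho> y t = (if y = z then s else 0)" by metis
  then show "x = y" using xy by (auto split: if_splits)
qed

lemma sent_diff: "0 \<le> u \<Longrightarrow> u \<le> t \<Longrightarrow> integral {u..t} (\<rho> x) = sent \<rho> x t - sent \<rho> x u"
  unfolding sent_def using Henstock_Kurzweil_Integration.integral_combine[of 0 u t "\<rho> x"] \<rho>_integrable by simp

lemma sent_mono:
  assumes "0 \<le> u" "u \<le> t"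
  shows "sent \<rho> x u \<le> sent \<rho> x t"
proof -
  have "0 \<le> integral {u..t} (\<rho> x)"
    by (rule integral_nonneg[OF \<rho>_integrable[OF assms(1)]]) (use assms \<rho>_nonneg in auto)
  then show ?thesis using sent_diff[OF assms] by simp
qed

lemma sent_le_len:
  assumes x: "x \<in> copies" and "0 \<le> T"
  shows "sent \<rho> x T \<le> len P (fst x)"
proof -
  let ?A = "\<lambda>t. sent \<rho> x t < len P (fst x)"
  have "sent \<rho> x T = integral {0..T} (\<lambda>t. if ?A t then \<rho> x t else 0)"
    unfolding sent_def[of \<rho> x T]
  proof (rule integral_cong)
    fix t assume "t \<in> {0..T}"
    then show "\<rho> x t = (if ?A t then \<rho> x t else 0)"
      using edf_cases[of t x] by (auto simp: pending_def)
  qed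
  also have "\<dots> \<le> len P (fst x)"
  proof (rule integral_down_closed_le(2)[OF \<open>0 \<le> T\<close>])
    show "?A u" if "0 \<le> u" "u \<le> t" "?A t" for u t using sent_mono[of u t x] that by simp
    show "integral {0..t} (\<rho> x) \<le> len P (fst x)" if "?A t" for t using that by (simp add: sent_def)
  qed (use \<rho>_integrable copy_len_pos[OF x] in auto)
  finally show ?thesis .
qed

text \<open>A copy released after \<open>u\<close> with deadline before \<open>v\<close> was broadcast by the simulation
  within \<open>[u - \<delta> (v - u), v]\<close>.\<close>

lemma demand_bound:
  assumes "0 \<le> u" "u \<le> v"
  shows "(\<Sum>x\<in>{x \<in> copies. u \<le> rel x \<and> dl x \<le> v}. len P (fst x)) \<le> s * (v - u)"
proof -
  define E where "E = {x \<in> copies. u \<le> rel x \<and> dl x \<le> v}"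
  have fE: "finite E" unfolding E_def using finite_released by simp
  define \<alpha> where "\<alpha> = max 0 (u - \<delta> * (v - u))"
  have "u - \<delta> * (v - u) \<le> u" using \<delta>_pos assms by simp
  then have \<alpha>: "0 \<le> \<alpha>" "\<alpha> \<le> v" unfolding \<alpha>_def using assms by auto
  have fK: "finite {k. (i, k) \<in> E}" for i
  proof (rule finite_surj[OF fE])
    show "{k. (i, k) \<in> E} \<subseteq> snd ` E" by force
  qed
  have "(\<Sum>x\<in>E. len P (fst x)) = (\<Sum>x\<in>Sigma (items P) (\<lambda>i. {k. (i, k) \<in> E}). len P (fst x))"
    by (rule sum.cong) (auto simp: E_def released_copies_def)
  also have "\<dots> = (\<Sum>i\<in>items P. \<Sum>k\<in>{k. (i, k) \<in> E}. len P i)"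
    using sum.Sigma[of "items P" "\<lambda>i. {k. (i, k) \<in> E}" "\<lambda>i k. len P i"] finite_items fK by (simp add: case_prod_beta')
  also have "\<dots> \<le> (\<Sum>i\<in>items P. integral {\<alpha>..v} (r i))"
  proof (rule sum_mono)
    fix i assume i: "i \<in> items P"
    have "real (card {k. (i, k) \<in> E}) * len P i \<le> broadcast_item.vol r i v - broadcast_item.vol r i \<alpha>"
    proof (rule broadcast_item.completions_between[OF item[OF i] fK])
      fix k assume "k \<in> {k. (i, k) \<in> E}"
      then have k: "(i, k) \<in> copies" "u \<le> rel (i, k)" "dl (i, k) \<le> v" by (auto simp: E_def)
      obtain b where b: "begin_date P r i k = ereal b" "completion_date P r i k = ereal (rel (i, k))"
        "0 \<le> b" "dl (i, k) = rel (i, k) + (rel (i, k) - b) / \<delta>" "rel (i, k) < dl (i, k)"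
        using copy_dates[OF k(1)] by metis
      have "rel (i, k) - b = \<delta> * (dl (i, k) - rel (i, k))" using b(4) \<delta>_pos by simp
      also have "\<dots> \<le> \<delta> * (v - u)" using k \<delta>_pos by (intro mult_left_mono) auto
      finally have "\<alpha> \<le> b" unfolding \<alpha>_def using b k by linarith
      then show "1 \<le> k \<and> ereal \<alpha> \<le> begin_date P r i k \<and> completion_date P r i k \<le> ereal v"
        using b k by (auto simp: released_copies_def)
    qed (use \<alpha> in auto)
    then show "(\<Sum>k\<in>{k. (i, k) \<in> E}. len P i) \<le> integral {\<alpha>..v} (r i)" using integral_rate[OF i \<alpha>] by simp
  qed
  also have "\<dots> = integral {\<alpha>..v} (\<lambda>t. \<Sum>i\<in>items P. r i t)"
    by (intro integral_sum[symmetric] finite_items broadcast_item.rate_integrable_sub[OF item] \<alpha>)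
  also have "\<dots> \<le> integral {\<alpha>..v} (\<lambda>t. \<sigma>)"
    by (intro integral_le integrable_sum finite_items broadcast_item.rate_integrable_sub[OF item] \<alpha>)
      (use schedule \<alpha> in \<open>auto simp: is_schedule_def\<close>)
  also have "\<dots> = \<sigma> * (v - \<alpha>)" using \<alpha> by simp
  also have "\<dots> \<le> \<sigma> * ((1 + \<delta>) * (v - u))"
  proof (rule mult_left_mono)
    have "u - \<delta> * (v - u) \<le> \<alpha>" by (simp add: \<alpha>_def)
    then show "v - \<alpha> \<le> (1 + \<delta>) * (v - u)" by (simp add: algebra_simps)
  qed (use \<sigma>_pos in simp)
  finally show ?thesis unfolding E_def s_eq by (simp add: mult.assoc)
qed

lemma deadline_met:
  assumes x: "x \<in> copies"
  shows "sent \<rho> x (dl x) = len P (fst x)"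
proof (rule ccontr)
  define d where "d = dl x"
  assume "\<not> ?thesis"
  moreover have d0: "0 \<le> d" unfolding d_def using copy_pos[OF x] rel_less_dl[OF x] by simp
  ultimately have miss: "sent \<rho> x d < len P (fst x)" using sent_le_len[OF x] by (force simp: d_def)
  define busy where "busy t \<longleftrightarrow> (\<exists>y\<in>pend t. dl y \<le> d)" for t
  define U where "U = {y \<in> copies. dl y \<le> d \<and> (\<forall>t\<in>{rel y..d}. busy t)}"
  have fU: "finite U" unfolding U_def using finite_released by simp
  have "x \<in> U"
    unfolding U_def busy_def
  proof (intro CollectI conjI ballI)
    fix t assume t: "t \<in> {rel x..d}"
    then have "sent \<rho> x t < len P (fst x)" using sent_mono[of t d x] copy_pos[OF x] miss by auto
    then have "x \<in> pend t" using x t by (auto simp: pending_def)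
    then show "\<exists>y\<in>pend t. dl y \<le> d" by (auto simp: d_def)
  qed (use x in \<open>auto simp: d_def\<close>)
  define u where "u = Min (rel ` U)"
  have "u \<in> rel ` U" unfolding u_def using fU \<open>x \<in> U\<close> by (intro Min_in) auto
  then obtain y0 where y0: "y0 \<in> U" "u = rel y0" by auto
  have u_le: "u \<le> rel y" if "y \<in> U" for y unfolding u_def using fU that by simp
  have u0: "0 \<le> u" using y0 copy_pos[of y0] by (simp add: U_def)
  have busy_u: "busy t" if "u \<le> t" "t \<le> d" for t using y0 that by (auto simp: U_def)
  have "u \<le> d" using u_le[OF \<open>x \<in> U\<close>] rel_less_dl[OF x] by (simp add: d_def)
  have old: "len P (fst y) \<le> sent \<rho> y u" if y: "y \<in> copies" "dl y \<le> d" "rel y < u" for y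
  proof (rule ccontr)
    assume n: "\<not> ?thesis"
    have "busy t" if t: "t \<in> {rel y..d}" for t
    proof (cases "t \<le> u")
      case True
      then have "sent \<rho> y t < len P (fst y)" using sent_mono[of t u y] copy_pos[OF y(1)] n t by auto
      then have "y \<in> pend t" using y t by (auto simp: pending_def)
      then show ?thesis using y unfolding busy_def by blast
    qed (use busy_u t in auto)
    then have "y \<in> U" using y by (simp add: U_def)
    then show False using u_le[of y] y(3) by simp
  qed
  define E where "E = {y \<in> copies. u \<le> rel y \<and> dl y \<le> d}"
  have fE: "finite E" unfolding E_def using finite_released by simp
  have "s * (d - u) = integral {u..d} (\<lambda>t. s)" using \<open>u \<le> d\<close> by simp
  also have "\<dots> = integral {u..d} (\<lambda>t. \<Sum>y\<in>E. \<rho> y t)"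
  proof (rule integral_cong)
    fix t assume t: "t \<in> {u..d}"
    then have t0: "0 \<le> t" using u0 by auto
    obtain y where y: "y \<in> pend t" "dl y \<le> d" using busy_u[of t] t by (auto simp: busy_def)
    then have ne: "pend t \<noteq> {}" by auto
    obtain z where z: "z \<in> pend t" "\<And>y. y \<in> pend t \<Longrightarrow> dl z \<le> dl y" "\<And>y. \<rho> y t = (if y = z then s else 0)"
      using edf_busy[OF t0 ne] by metis
    have zd: "dl z \<le> d" using z(2)[OF y(1)] y(2) by simp
    have "u \<le> rel z"
    proof (rule ccontr)
      assume "\<not> u \<le> rel z"
      then have "len P (fst z) \<le> sent \<rho> z u" using old[of z] z(1) zd pend_sub by auto
      then show False using sent_mono[of u t z] u0 t z(1) by (auto simp: pending_def)
    qed
    then have "z \<in> E" using z(1) zd pend_sub by (auto simp: E_def)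
    then show "s = (\<Sum>y\<in>E. \<rho> y t)" using z(3) fE by simp
  qed
  also have "\<dots> = (\<Sum>y\<in>E. integral {u..d} (\<rho> y))"
    by (intro integral_sum fE \<rho>_integrable u0)
  also have "\<dots> < (\<Sum>y\<in>E. len P (fst y))"
  proof (rule sum_strict_mono_ex1[OF fE])
    have le: "integral {u..d} (\<rho> y) \<le> sent \<rho> y d" for y
      using sent_diff[OF u0 \<open>u \<le> d\<close>, of y] sent_mono[OF _ u0, of y] by (simp add: sent_def)
    show "\<forall>y\<in>E. integral {u..d} (\<rho> y) \<le> len P (fst y)"
    proof
      fix y assume "y \<in> E"
      then have "sent \<rho> y d \<le> len P (fst y)" using sent_le_len[OF _ d0] by (simp add: E_def)
      then show "integral {u..d} (\<rho> y) \<le> len P (fst y)" using le[of y] by simp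
    qed
    have "x \<in> E" using u_le[OF \<open>x \<in> U\<close>] x by (simp add: E_def d_def)
    moreover have "integral {u..d} (\<rho> x) < len P (fst x)" using le[of x] miss by simp
    ultimately show "\<exists>y\<in>E. integral {u..d} (\<rho> y) < len P (fst y)" by blast
  qed
  also have "\<dots> \<le> s * (d - u)" unfolding E_def by (rule demand_bound[OF u0 \<open>u \<le> d\<close>])
  finally show False by simp
qed

lemma broadcast_copies_eq: "broadcast_copies \<rho> = copies"
proof
  show "broadcast_copies \<rho> \<subseteq> copies"
    unfolding broadcast_copies_def using \<rho>_pos_pend pend_sub by blast
  show "copies \<subseteq> broadcast_copies \<rho>"
  proof
    fix x assume x: "x \<in> copies"
    show "x \<in> broadcast_copies \<rho>"
    proof (rule ccontr)
      assume "x \<notin> broadcast_copies \<rho>"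
      then have "\<rho> x t = 0" if "0 \<le> t" for t
        using \<rho>_nonneg[OF that, of x] that by (fastforce simp: broadcast_copies_def)
      then have "sent \<rho> x (dl x) = integral {0..dl x} (\<lambda>_. 0)"
        unfolding sent_def by (intro integral_cong) auto
      then show False using deadline_met[OF x] copy_len_pos[OF x] by simp
    qed
  qed
qed

lemma \<rho>_sum_le:
  assumes t: "0 \<le> t"
  shows "(\<Sum>x\<in>copies. \<rho> x t) \<le> s"
proof (cases "pend t = {}")
  case False
  from edf_busy[OF t False] obtain z where "\<And>y. \<rho> y t = (if y = z then s else 0)" by metis
  then show ?thesis using finite_released s_pos by simp
qed (use edf_idle[OF t] s_pos in simp)

lemma copy_schedule: "is_copy_schedule P s \<rho>"
proof -
  have fK: "finite {k. (i, k) \<in> copies}" for i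
  proof (rule finite_surj[OF finite_released])
    show "{k. (i, k) \<in> copies} \<subseteq> snd ` copies" by force
  qed
  have n: "0 \<le> item_rate \<rho> i t" if "0 \<le> t" for i t
    unfolding item_rate_def using \<rho>_nonneg[OF that] by (intro sum_nonneg) auto
  have le: "(\<Sum>i\<in>items P. item_rate \<rho> i t) \<le> s" if "0 \<le> t" for t
  proof -
    have "(\<Sum>i\<in>items P. item_rate \<rho> i t) = (\<Sum>i\<in>items P. \<Sum>k\<in>{k. (i, k) \<in> copies}. \<rho> (i, k) t)"
      unfolding item_rate_def broadcast_copies_eq ..
    also have "\<dots> = (\<Sum>x\<in>Sigma (items P) (\<lambda>i. {k. (i, k) \<in> copies}). \<rho> x t)"
      using sum.Sigma[of "items P" "\<lambda>i. {k. (i, k) \<in> copies}" "\<lambda>i k. \<rho> (i, k) t"] finite_items fK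
      by (simp add: case_prod_beta')
    also have "\<dots> = (\<Sum>x\<in>copies. \<rho> x t)" by (rule sum.cong) (auto simp: released_copies_def)
    finally show ?thesis using \<rho>_sum_le[OF that] by simp
  qed
  have le1: "item_rate \<rho> i t \<le> s" if "i \<in> items P" "0 \<le> t" for i t
    by (rule order_trans[OF member_le_sum[OF that(1), of "\<lambda>i. item_rate \<rho> i t"] le[OF that(2)]])
      (auto simp: n that finite_items)
  have "item_rate \<rho> i integrable_on {0..T}" for i T
    unfolding item_rate_def[abs_def] broadcast_copies_eq by (intro integrable_sum fK \<rho>_integrable) simp
  then have "is_schedule P s (item_rate \<rho>)"
    unfolding is_schedule_def using n le le1 by auto
  moreover have "fst ` copies \<subseteq> items P" by (auto simp: released_copies_def)
  ultimately show ?thesis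
    unfolding is_copy_schedule_def broadcast_copies_eq using finite_released \<rho>_nonneg \<rho>_integrable by auto
qed

lemma copy_request_completion:
  assumes j: "j < q"
  shows "request_completion P (copy_broadcasts_of P \<rho>) j \<le> ereal (a j + (1 + 1 / \<delta>) * (ctime j - a j))"
proof -
  have "reception_date (copy_broadcasts_of P \<rho> i) (a j) \<le> ereal (a j + (1 + 1 / \<delta>) * (ctime j - a j))"
    if i: "i \<in> request P j" for i
  proof -
    have ii: "i \<in> items P" using i request_sub[OF j] by auto
    obtain k where k: "1 \<le> k" "ereal (a j) \<le> begin_date P r i k" "completion_date P r i k = rec j i"
      by (rule broadcast_item.reception_attained[OF item[OF ii] reception_finite[OF j i] arrival_nonneg[OF j]])
    have c: "(i, k) \<in> copies" using k ii reception_finite[OF j i] by (auto simp: released_copies_def)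
    obtain b where b: "begin_date P r i k = ereal b" "completion_date P r i k = ereal (rel (i, k))"
      "b < rel (i, k)" "dl (i, k) = rel (i, k) + (rel (i, k) - b) / \<delta>"
      using copy_dates[OF c] by metis
    have "rec j i \<le> request_completion P (broadcasts_of P r) j"
      unfolding request_completion_def using finite_request[OF j] i by (intro Max_ge) auto
    then have rc: "rel (i, k) \<le> ctime j" using request_completion_eq(1)[OF j] b k by simp
    have ab: "a j \<le> b" using k b by simp
    have "dl (i, k) \<le> ctime j + (ctime j - a j) / \<delta>"
      unfolding b(4) using rc ab \<delta>_pos by (intro add_mono divide_right_mono) auto
    also have "\<dots> = a j + (1 + 1 / \<delta>) * (ctime j - a j)" by (simp add: distrib_right)
    finally have dle: "dl (i, k) \<le> a j + (1 + 1 / \<delta>) * (ctime j - a j)" .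
    have "ereal (rel (i, k)) \<le> copy_begin_date \<rho> (i, k)"
      unfolding copy_begin_date_def using \<rho>_pos_pend[of _ "(i, k)"] by (intro Inf_greatest) (auto simp: pending_def)
    moreover have "a j \<le> rel (i, k)" using ab b by simp
    ultimately have "ereal (a j) \<le> copy_begin_date \<rho> (i, k)" by (meson ereal_less_eq(3) order_trans)
    then have "reception_date (copy_broadcasts_of P \<rho> i) (a j) \<le> copy_completion_date P \<rho> (i, k)"
      unfolding reception_date_def copy_broadcasts_of_def using c broadcast_copies_eq by (intro Inf_lower) auto
    also have "\<dots> \<le> ereal (dl (i, k))"
      unfolding copy_completion_date_def using deadline_met[OF c] copy_pos[OF c] rel_less_dl[OF c]
      by (intro Inf_lower) auto
    also have "\<dots> \<le> ereal (a j + (1 + 1 / \<delta>) * (ctime j - a j))" using dle by simp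
    finally show ?thesis .
  qed
  then show ?thesis
    unfolding request_completion_def using finite_request[OF j] request_ne[OF j] by (intro Max.boundedI) auto
qed

lemma copy_flow_time:
  "flow_time P (copy_broadcasts_of P \<rho>) \<le> ereal ((1 + 1 / \<delta>) * (\<Sum>j<q. ctime j - a j))"
proof -
  have "flow_time P (copy_broadcasts_of P \<rho>) \<le> (\<Sum>j<q. ereal ((1 + 1 / \<delta>) * (ctime j - a j)))"
    unfolding flow_time_def
  proof (rule sum_mono)
    fix j assume "j \<in> {..<q}"
    then have "request_completion P (copy_broadcasts_of P \<rho>) j - ereal (a j)
        \<le> ereal (a j + (1 + 1 / \<delta>) * (ctime j - a j)) - ereal (a j)"
      by (intro ereal_minus_mono copy_request_completion) auto
    then show "request_completion P (copy_broadcasts_of P \<rho>) j - ereal (a j)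
        \<le> ereal ((1 + 1 / \<delta>) * (ctime j - a j))" by simp
  qed
  then show ?thesis by (simp add: sum_distrib_left)
qed

lemma preemption_gap:
  assumes "0 < u"
  obtains l where "0 \<le> l" "l < u" "\<And>y. y \<in> copies \<Longrightarrow> l < rel y \<Longrightarrow> u \<le> rel y"
proof -
  define l where "l = Max (insert 0 (rel ` {y \<in> copies. rel y < u}))"
  have fin: "finite (insert 0 (rel ` {y \<in> copies. rel y < u}))" using finite_released by simp
  have "0 \<le> l" unfolding l_def using fin by (intro Max_ge) auto
  moreover have "l < u" unfolding l_def using fin assms by (subst Max_less_iff) auto
  moreover have "u \<le> rel y" if "y \<in> copies" "l < rel y" for y
  proof (rule ccontr)
    assume "\<not> u \<le> rel y"
    then have "rel y \<le> l" unfolding l_def using fin that by (intro Max_ge) auto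
    then show False using that by simp
  qed
  ultimately show ?thesis using that by blast
qed

lemma preemption_before:
  assumes "(x, u) \<in> preemptions P \<rho>" "l < u"
  obtains t where "l < t" "t < u" "0 < \<rho> x t"
proof -
  have "\<exists>\<^sub>F t in at_left u. 0 < \<rho> x t" using assms by (simp add: preemptions_def)
  moreover have "\<forall>\<^sub>F t in at_left u. t \<in> {l<..<u}" by (rule eventually_at_left_real[OF assms(2)])
  ultimately have "\<exists>\<^sub>F t in at_left u. 0 < \<rho> x t \<and> t \<in> {l<..<u}" by (rule frequently_eventually_frequently)
  then show ?thesis using that frequently_ex by force
qed

lemma preempted_pending:
  assumes "(x, u) \<in> preemptions P \<rho>" "0 \<le> t" "0 < \<rho> x t" "t \<le> t'" "t' \<le> u"
  shows "x \<in> pend t'"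
proof -
  have "x \<in> pend t" using \<rho>_pos_pend assms by auto
  moreover have "sent \<rho> x t' < len P (fst x)"
    using sent_mono[of t' u x] assms by (auto simp: preemptions_def)
  ultimately show ?thesis using assms by (auto simp: pending_def)
qed

text \<open>A preemption occurs only when a copy is released, and only one copy is preempted then.\<close>

lemma preempted_at_most_once_on_average: "preempted_at_most_once_on_average P \<rho>"
proof -
  have sub: "snd ` preemptions P \<rho> \<subseteq> rel ` copies"
  proof clarsimp
    fix i k u assume p: "((i, k), u) \<in> preemptions P \<rho>"
    let ?x = "(i, k)"
    have u: "0 < u" "\<not> 0 < \<rho> ?x u" using p by (auto simp: preemptions_def)
    obtain l where l: "0 \<le> l" "l < u" "\<And>y. y \<in> copies \<Longrightarrow> l < rel y \<Longrightarrow> u \<le> rel y"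
      by (rule preemption_gap[OF u(1)]) blast
    obtain t where t: "l < t" "t < u" "0 < \<rho> ?x t" by (rule preemption_before[OF p l(2)]) blast
    have "?x \<in> pend u" using preempted_pending[OF p, of t u] t l by auto
    then obtain y where "y \<in> copies" "t < rel y" "rel y \<le> u"
      using edf_continue[of t u ?x] t l u by fastforce
    then show "u \<in> rel ` copies" using l(3)[of y] t by force
  qed
  have inj: "inj_on snd (preemptions P \<rho>)"
  proof (rule inj_onI, clarsimp)
    fix i i' :: 'i and k k' :: nat and u
    let ?x = "(i, k)" and ?y = "(i', k')"
    assume p: "(?x, u) \<in> preemptions P \<rho>" and p': "(?y, u) \<in> preemptions P \<rho>"
    have u: "0 < u" using p by (auto simp: preemptions_def)
    obtain l where l: "0 \<le> l" "l < u" "\<And>y. y \<in> copies \<Longrightarrow> l < rel y \<Longrightarrow> u \<le> rel y"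
      by (rule preemption_gap[OF u]) blast
    obtain t where t: "l < t" "t < u" "0 < \<rho> ?x t" by (rule preemption_before[OF p l(2)]) blast
    obtain t' where t': "t < t'" "t' < u" "0 < \<rho> ?y t'" by (rule preemption_before[OF p' t(2)]) blast
    have "0 < \<rho> ?x t'"
    proof (rule edf_continue)
      show "?x \<in> pend t'" using preempted_pending[OF p, of t t'] t t' l by auto
      show "dl ?x \<le> dl y" if "y \<in> copies" "t < rel y" "rel y \<le> t'" for y
        using l(3)[of y] that t t' by auto
    qed (use t t' l in auto)
    then have "?x = ?y" using one_at_a_time t' t l unfolding one_at_a_time_def
      by (meson le_less_trans less_imp_le)
    then show "i = i' \<and> k = k'" by simp
  qed
  have fin: "finite (rel ` copies)" using finite_released by simp
  have "finite (preemptions P \<rho>)" using inj sub fin by (metis finite_imageD finite_subset)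
  moreover have "card (preemptions P \<rho>) \<le> card copies"
    using card_image[OF inj] card_mono[OF fin sub] card_image_le[OF finite_released, of rel] by linarith
  ultimately show ?thesis
    unfolding preempted_at_most_once_on_average_def broadcast_copies_eq using finite_released by simp
qed

end

section \<open>Existence of B-EquiSet executions\<close>

definition regular_shares :: "(nat \<Rightarrow> 'i \<Rightarrow> real \<Rightarrow> real) \<Rightarrow> bool" where
  "regular_shares w \<longleftrightarrow> (\<forall>j i t. 0 \<le> t \<longrightarrow> 0 \<le> w j i t) \<and> (\<forall>j i T. w j i integrable_on {0..T})"

definition alive_pairs :: "'i broadcast_instance \<Rightarrow> (nat \<Rightarrow> 'i \<Rightarrow> real \<Rightarrow> real) \<Rightarrow> real \<Rightarrow> (nat \<times> 'i) set" where
  "alive_pairs P w t = {(j, i). j < num_requests P \<and> alive_item P (total_rate P w) t j i}"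

definition single_item_share :: "real \<Rightarrow> (nat \<times> 'i) set \<Rightarrow> nat \<Rightarrow> 'i \<Rightarrow> real" where
  "single_item_share \<sigma> A j i =
     (if j \<in> fst ` A \<and> i = (SOME i. (j, i) \<in> A) then \<sigma> / real (card (fst ` A)) else 0)"

lemma single_item_share_nonneg: "0 \<le> \<sigma> \<Longrightarrow> 0 \<le> single_item_share \<sigma> A j i"
  by (simp add: single_item_share_def)

lemma some_alive_item: "j \<in> fst ` A \<Longrightarrow> (j, SOME i. (j, i) \<in> A) \<in> A"
  by (rule someI_ex) force

lemma b_equisetI:
  assumes valid: "valid_instance P" and "0 \<le> \<sigma>" and w: "regular_shares w"
    and fixpt: "\<And>t j i. 0 \<le> t \<Longrightarrow> w j i t = single_item_share \<sigma> (alive_pairs P w t) j i"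
  shows "b_equiset \<sigma> P w"
proof -
  have R: "alive_requests P (total_rate P w) t = fst ` alive_pairs P w t" for t
    by (force simp: alive_requests_def alive_pairs_def)
  have dead: "w j i t = 0" if "0 \<le> t" "\<not> alive_item P (total_rate P w) t j i" for j i t
  proof -
    have "(j, i) \<notin> alive_pairs P w t" using that by (simp add: alive_pairs_def)
    then show ?thesis using some_alive_item[of j "alive_pairs P w t"] fixpt[OF that(1), of j i]
      by (auto simp: single_item_share_def)
  qed
  have share: "(\<Sum>i\<in>request P j. w j i t) = \<sigma> / real (card (alive_requests P (total_rate P w) t))"
    if "0 \<le> t" "j < num_requests P" "j \<in> alive_requests P (total_rate P w) t" for j t
  proof -
    let ?A = "alive_pairs P w t" let ?i = "SOME i. (j, i) \<in> ?A"
    have j: "j \<in> fst ` ?A" using that R by simp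
    have "?i \<in> request P j" using some_alive_item[OF j] by (auto simp: alive_pairs_def alive_item_def)
    moreover have "finite (request P j)"
      using valid that by (auto simp: valid_instance_def intro: finite_subset)
    moreover have "w j i t = (if i = ?i then \<sigma> / real (card (fst ` ?A)) else 0)" for i
      using fixpt[OF that(1), of j i] j by (simp add: single_item_share_def)
    ultimately show ?thesis using R by simp
  qed
  show ?thesis unfolding b_equiset_def
  proof (intro conjI allI impI ballI)
    fix j i T show "w j i integrable_on {0..T}" using w by (simp add: regular_shares_def)
  next
    fix t :: real and j i assume "0 \<le> t" then show "0 \<le> w j i t" using w by (simp add: regular_shares_def)
  qed (use dead share in auto)
qed

lemma regular_shares_item:
  assumes "valid_instance P" "regular_shares w" "i \<in> items P"
  shows "broadcast_item P (total_rate P w) i"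
proof
  show "0 < len P i" using assms by (simp add: valid_instance_def)
  show "0 \<le> total_rate P w i t" if "0 \<le> t" for t
    unfolding total_rate_def using assms that by (intro sum_nonneg) (simp add: regular_shares_def)
  show "total_rate P w i integrable_on {0..T}" for T
    unfolding total_rate_def[abs_def] using assms by (intro integrable_sum) (simp_all add: regular_shares_def)
qed

lemma alive_item_iff:
  assumes "valid_instance P" "regular_shares w" "j < num_requests P" "i \<in> request P j" "arrival P j \<le> t"
  shows "alive_item P (total_rate P w) t j i \<longleftrightarrow>
    (\<forall>k\<ge>1. (\<forall>\<tau>. 0 \<le> \<tau> \<and> \<tau> < arrival P j \<and> real (k - 1) * len P i \<le> integral {0..\<tau>} (total_rate P w i)
        \<longrightarrow> \<not> 0 < total_rate P w i \<tau>)
      \<longrightarrow> integral {0..t} (total_rate P w i) < real k * len P i)"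
proof -
  have "i \<in> items P" "0 \<le> t" using assms by (auto simp: valid_instance_def)
  interpret I: broadcast_item P "total_rate P w" i by (rule regular_shares_item) fact+
  have "alive_item P (total_rate P w) t j i \<longleftrightarrow>
      \<not> reception_date (broadcasts_of P (total_rate P w) i) (arrival P j) \<le> ereal t"
    using assms by (auto simp: alive_item_def)
  then show ?thesis unfolding I.reception_le_iff[OF \<open>0 \<le> t\<close>] I.begin_ge_iff I.vol_def not_le[symmetric]
    by blast
qed

lemma alive_pairs_local:
  assumes valid: "valid_instance P" and w: "regular_shares w" and w': "regular_shares w'"
    and eq: "\<And>j i t. 0 \<le> t \<Longrightarrow> t < T \<Longrightarrow> w j i t = w' j i t" and t: "0 \<le> t" "t \<le> T"
  shows "alive_pairs P w t = alive_pairs P w' t"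
proof -
  have r: "total_rate P w i \<tau> = total_rate P w' i \<tau>" if "0 \<le> \<tau>" "\<tau> < T" for i \<tau>
    unfolding total_rate_def using eq that by simp
  have int: "integral {0..\<tau>} (total_rate P w i) = integral {0..\<tau>} (total_rate P w' i)"
    if "\<tau> \<le> T" for i \<tau>
    by (rule integral_spike[where S = "{T}"]) (use r that in auto)
  have "alive_item P (total_rate P w) t j i \<longleftrightarrow> alive_item P (total_rate P w') t j i"
    if j: "j < num_requests P" for j i
  proof (cases "i \<in> request P j \<and> arrival P j \<le> t")
    case True
    then have *: "i \<in> request P j" "arrival P j \<le> t" by auto
    have "(0 \<le> \<tau> \<and> \<tau> < arrival P j \<and> c \<le> integral {0..\<tau>} (total_rate P w i) \<longrightarrow> \<not> 0 < total_rate P w i \<tau>)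
      \<longleftrightarrow> (0 \<le> \<tau> \<and> \<tau> < arrival P j \<and> c \<le> integral {0..\<tau>} (total_rate P w' i) \<longrightarrow> \<not> 0 < total_rate P w' i \<tau>)"
      for c \<tau>
      using r[of \<tau> i] int[of \<tau> i] * t by auto
    then show ?thesis
      unfolding alive_item_iff[OF valid w j *] alive_item_iff[OF valid w' j *] int[OF t(2)] by simp
  qed (auto simp: alive_item_def)
  then show ?thesis by (auto simp: alive_pairs_def)
qed

definition future_events :: "'i broadcast_instance \<Rightarrow> (nat \<Rightarrow> 'i \<Rightarrow> real \<Rightarrow> real) \<Rightarrow> real \<Rightarrow> nat" where
  "future_events P w T = card {j. j < num_requests P \<and> T < arrival P j} +
     card {(j, i). j < num_requests P \<and> i \<in> request P j \<and> (T < arrival P j \<or> (j, i) \<in> alive_pairs P w T)}"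

lemma b_equiset_extend:
  assumes valid: "valid_instance P" and \<sigma>: "0 < \<sigma>"
  shows "regular_shares w \<Longrightarrow> 0 \<le> T \<Longrightarrow>
    (\<And>t j i. 0 \<le> t \<Longrightarrow> t < T \<Longrightarrow> w j i t = single_item_share \<sigma> (alive_pairs P w t) j i) \<Longrightarrow>
    \<exists>w'. b_equiset \<sigma> P w'"
proof (induction "future_events P w T" arbitrary: w T rule: less_induct)
  case less
  note w = less.prems(1) and T = less.prems(2) and fix_w = less.prems(3)
  let ?q = "num_requests P" and ?a = "arrival P"
  define w' where "w' j i t = (if t < T then w j i t else single_item_share \<sigma> (alive_pairs P w T) j i)" for j i t
  have w': "regular_shares w'"
    unfolding regular_shares_def
  proof (intro conjI allI impI)
    fix j i and t :: real assume "0 \<le> t"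
    then show "0 \<le> w' j i t" using w \<sigma> by (simp add: w'_def regular_shares_def single_item_share_nonneg)
  next
    fix j i and S :: real
    have "(\<lambda>t. (if t < T then w j i t else 0) + (if T \<le> t then single_item_share \<sigma> (alive_pairs P w T) j i else 0))
      integrable_on {0..S}"
      using w by (intro integrable_add integrable_if_less integrable_if_ge integrable_const_ivl)
        (simp add: regular_shares_def)
    then show "w' j i integrable_on {0..S}" by (rule integrable_eq) (auto simp: w'_def)
  qed
  have loc: "alive_pairs P w t = alive_pairs P w' t" if "0 \<le> t" "t \<le> T" for t
    by (rule alive_pairs_local[OF valid w w' _ that]) (simp add: w'_def)
  define e where "e j i = reception_date (broadcasts_of P (total_rate P w') i) (?a j)" for j i
  have pairs: "alive_pairs P w' t = {(j, i). j < ?q \<and> i \<in> request P j \<and> ?a j \<le> t \<and> ereal t < e j i}" for t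
    by (auto simp: alive_pairs_def alive_item_def e_def)
  have e_ge: "ereal (?a j) \<le> e j i" if "j < ?q" "i \<in> request P j" for j i
    unfolding e_def
    by (rule broadcast_item.reception_ge[OF regular_shares_item[OF valid w']])
      (use valid that in \<open>auto simp: valid_instance_def\<close>)
  have finq: "finite {(j, i). j < ?q \<and> i \<in> request P j}"
  proof (rule finite_subset)
    show "{(j, i). j < ?q \<and> i \<in> request P j} \<subseteq> {..<?q} \<times> items P" using valid by (auto simp: valid_instance_def)
  qed (use valid in \<open>simp add: valid_instance_def\<close>)
  define Ev where "Ev = {x. T < x \<and> ((\<exists>j<?q. x = ?a j) \<or> (\<exists>j<?q. \<exists>i\<in>request P j. ereal x = e j i))}"
  have finEv: "finite Ev"
  proof (rule finite_subset)
    show "Ev \<subseteq> ?a ` {..<?q} \<union> (\<lambda>(j, i). real_of_ereal (e j i)) ` {(j, i). j < ?q \<and> i \<in> request P j}"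
      by (force simp: Ev_def dest: arg_cong[where f = real_of_ereal])
  qed (use finq in auto)
  have const: "alive_pairs P w' t = alive_pairs P w' T" if "T \<le> t" and no: "\<And>x. x \<in> Ev \<Longrightarrow> t < x" for t
  proof -
    have "?a j \<le> t \<longleftrightarrow> ?a j \<le> T" if "j < ?q" for j
      using no[of "?a j"] that \<open>T \<le> t\<close> by (force simp: Ev_def)
    moreover have "ereal t < e j i \<longleftrightarrow> ereal T < e j i" if ji: "j < ?q" "i \<in> request P j" for j i
    proof (cases "e j i")
      case (real x)
      then show ?thesis using no[of x] ji \<open>T \<le> t\<close> by (force simp: Ev_def)
    qed auto
    ultimately show ?thesis unfolding pairs by blast
  qed
  have fix_w': "w' j i t = single_item_share \<sigma> (alive_pairs P w' t) j i"
    if "0 \<le> t" "\<And>x. x \<in> Ev \<Longrightarrow> t < x" for j i t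
  proof (cases "t < T")
    case True
    then show ?thesis using fix_w[of t j i] loc[of t] that by (simp add: w'_def)
  next
    case False
    then show ?thesis using const[of t] loc[of T] that T by (simp add: w'_def)
  qed
  show ?case
  proof (cases "Ev = {}")
    case True
    have "b_equiset \<sigma> P w'"
      by (rule b_equisetI[OF valid _ w' fix_w']) (use True \<sigma> in auto)
    then show ?thesis by blast
  next
    case False
    define T' where "T' = Min Ev"
    have T': "T' \<in> Ev" "\<And>x. x \<in> Ev \<Longrightarrow> T' \<le> x" using finEv False by (auto simp: T'_def)
    have TT': "T < T'" using T'(1) by (simp add: Ev_def)
    let ?A = "\<lambda>S. {j. j < ?q \<and> S < ?a j}"
    let ?B = "\<lambda>S. {(j, i). j < ?q \<and> i \<in> request P j \<and> ereal S < e j i}"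
    have fe: "future_events P w' S = card (?A S) + card (?B S)" for S
    proof -
      have "S < ?a j \<or> (j, i) \<in> alive_pairs P w' S \<longleftrightarrow> ereal S < e j i" if "j < ?q" "i \<in> request P j" for j i
        using e_ge[OF that] less_le_trans[of "ereal S" "ereal (?a j)" "e j i"] that by (auto simp: pairs)
      then have "{(j, i). j < ?q \<and> i \<in> request P j \<and> (S < ?a j \<or> (j, i) \<in> alive_pairs P w' S)} = ?B S" by blast
      then show ?thesis unfolding future_events_def by simp
    qed
    have fin: "finite (?A T)" "finite (?B T)" by simp (rule finite_subset[OF _ finq], blast)
    have lt: "ereal T < c" if "ereal T' < c" for c using that TT' less_trans[of "ereal T" "ereal T'" c] by simp
    have sub: "?A T' \<subseteq> ?A T" "?B T' \<subseteq> ?B T" using TT' lt by auto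
    have "?A T' \<noteq> ?A T \<or> ?B T' \<noteq> ?B T"
    proof -
      consider j where "j < ?q" "T' = ?a j" | j i where "j < ?q" "i \<in> request P j" "ereal T' = e j i"
        using T'(1) by (auto simp: Ev_def)
      then show ?thesis
      proof cases
        case 1
        then have "j \<in> ?A T" "j \<notin> ?A T'" using TT' by auto
        then show ?thesis by blast
      next
        case 2
        then have "(j, i) \<in> ?B T" "(j, i) \<notin> ?B T'" using TT' by (auto simp flip: 2(3))
        then show ?thesis by blast
      qed
    qed
    then have "card (?A T') < card (?A T) \<or> card (?B T') < card (?B T)"
      using psubset_card_mono[OF fin(1), of "?A T'"] psubset_card_mono[OF fin(2), of "?B T'"] sub by blast
    then have "future_events P w' T' < future_events P w' T"
      unfolding fe using card_mono[OF fin(1) sub(1)] card_mono[OF fin(2) sub(2)] by linarith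
    also have "future_events P w' T = future_events P w T" unfolding future_events_def using loc[of T] T by simp
    finally show ?thesis
    proof (rule less.hyps[OF _ w'])
      show "w' j i t = single_item_share \<sigma> (alive_pairs P w' t) j i" if "0 \<le> t" "t < T'" for t j i
        by (rule fix_w') (use that T'(2) in force)+
    qed (use T TT' in auto)
  qed
qed

lemma b_equiset_exists:
  assumes "valid_instance P" "0 < \<sigma>"
  shows "\<exists>w. b_equiset \<sigma> P w"
  by (rule b_equiset_extend[OF assms, of "\<lambda>_ _ _. 0" 0]) (auto simp: regular_shares_def integrable_0)

section \<open>Existence of EDF schedules\<close>

lemma integral_stopped:
  fixes g :: "real \<Rightarrow> real" and l :: real
  assumes g: "\<And>T. g integrable_on {0..T}" "\<And>t. 0 \<le> t \<Longrightarrow> 0 \<le> g t"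
  defines "f \<equiv> \<lambda>t. if integral {0..t} g < l then g t else 0"
  shows "f integrable_on {0..T}"
    and "0 \<le> T \<Longrightarrow> integral {0..T} f < l \<longleftrightarrow> integral {0..T} g < l"
proof -
  define G where "G t = integral {0..t} g" for t
  have mono: "G u \<le> G t" if "0 \<le> u" "u \<le> t" for u t
    unfolding G_def using that g by (intro integral_subset_le) auto
  have down: "G u < l" if "0 \<le> u" "u \<le> t" "G t < l" for u t using mono[of u t] that by simp
  have *: "f integrable_on {0..T} \<and> (integral {0..T} f < l \<longleftrightarrow> G T < l)" if "0 \<le> T"
  proof (rule integral_initial_segment[OF that g(1), of "\<lambda>t. G t < l"])
    fix \<tau> assume \<tau>: "0 \<le> \<tau>" "\<tau> \<le> T" "\<And>t. \<tau> < t \<Longrightarrow> t \<le> T \<Longrightarrow> \<not> G t < l"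
      and int: "((\<lambda>t. if G t < l then g t else 0) has_integral integral {0..\<tau>} g) {0..T}"
    have f: "(f has_integral G \<tau>) {0..T}" using int by (simp add: f_def G_def)
    have "G T < l" if G\<tau>: "G \<tau> < l"
    proof (rule ccontr)
      assume n: "\<not> G T < l"
      then have "\<tau> < T" using that \<tau> by (cases "\<tau> = T") auto
      have "continuous_on {0..T} G" unfolding G_def by (rule indefinite_integral_continuous_1[OF g(1)])
      then have "continuous_on {\<tau>..T} G" by (rule continuous_on_subset) (use \<tau> in auto)
      then obtain c where c: "\<tau> \<le> c" "c \<le> T" "G c = (G \<tau> + l) / 2"
        using IVT'[of G \<tau> "(G \<tau> + l) / 2" T] G\<tau> n \<tau> by auto
      then have "G c < l" "c \<noteq> \<tau>" using that by auto
      then show False using \<tau>(3)[of c] c by auto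
    qed
    moreover have "G \<tau> \<le> G T" using mono \<tau> by simp
    ultimately show ?thesis using f by (auto simp: integral_unique)
  qed (use down in auto)
  then show "f integrable_on {0..T}" by (cases "0 \<le> T") auto
  show "integral {0..T} f < l \<longleftrightarrow> integral {0..T} g < l" if "0 \<le> T"
    using * that by (simp add: G_def)
qed

lemma priority_schedule_exists:
  fixes rel l :: "'x \<Rightarrow> real" and \<kappa> :: "'x \<Rightarrow> nat"
  assumes "finite D" "inj_on \<kappa> D" "0 < s"
  defines "pnd \<equiv> \<lambda>D \<rho> t. {x \<in> D. rel x \<le> t \<and> integral {0..t} (\<rho> x) < l x}"
  shows "\<exists>\<rho> :: 'x \<Rightarrow> real \<Rightarrow> real. (\<forall>x T. \<rho> x integrable_on {0..T}) \<and>
    (\<forall>t\<ge>0. \<forall>x. \<rho> x t = (if x \<in> pnd D \<rho> t \<and> (\<forall>y\<in>pnd D \<rho> t. \<kappa> x \<le> \<kappa> y) then s else 0))"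
  using assms(1,2)
proof (induction rule: finite_ranking_induct[where f = \<kappa>])
  case empty
  show ?case by (rule exI[of _ "\<lambda>_ _. 0"]) (simp add: pnd_def integrable_0)
next
  case (insert x S)
  from insert.prems have inj: "inj_on \<kappa> S" and lt: "\<And>y. y \<in> S \<Longrightarrow> y \<noteq> x \<Longrightarrow> \<kappa> y < \<kappa> x"
    using insert.hyps(2) by (auto simp: inj_on_def le_less)
  show ?case
  proof (cases "x \<in> S")
    case True
    then show ?thesis using insert.IH inj by (simp add: insert_absorb)
  next
    case False
    from insert.IH[OF inj] obtain \<rho> where int: "\<And>x T. \<rho> x integrable_on {0..T}"
      and \<rho>: "\<And>t x. 0 \<le> t \<Longrightarrow> \<rho> x t = (if x \<in> pnd S \<rho> t \<and> (\<forall>y\<in>pnd S \<rho> t. \<kappa> x \<le> \<kappa> y) then s else 0)"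
      by blast
    have sum: "(\<Sum>y\<in>S. \<rho> y t) = (if pnd S \<rho> t = {} then 0 else s)" if t: "0 \<le> t" for t
    proof (cases "pnd S \<rho> t = {}")
      case True
      then show ?thesis using \<rho>[OF t] by simp
    next
      case ne: False
      have fin: "finite (pnd S \<rho> t)" using insert.hyps(1) by (simp add: pnd_def)
      then obtain z where z: "z \<in> pnd S \<rho> t" "\<And>y. y \<in> pnd S \<rho> t \<Longrightarrow> \<kappa> z \<le> \<kappa> y"
        using ne by (metis arg_min_if_finite(1) arg_min_least)
      have sub: "pnd S \<rho> t \<subseteq> S" by (auto simp: pnd_def)
      have "\<rho> y t = (if y = z then s else 0)" for y
      proof (cases "y = z")
        case False
        have "\<not> (y \<in> pnd S \<rho> t \<and> \<kappa> y \<le> \<kappa> z)"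
          using z sub False inj by (metis dual_order.antisym in_mono inj_on_eq_iff)
        then show ?thesis using \<rho>[OF t, of y] z(1) False by auto
      qed (use \<rho>[OF t, of z] z in auto)
      moreover have "z \<in> S" using z sub by auto
      ultimately show ?thesis using ne insert.hyps(1) by simp
    qed
    define g where "g t = (if rel x \<le> t then s - (\<Sum>y\<in>S. \<rho> y t) else 0)" for t
    have g: "g t = (if rel x \<le> t \<and> pnd S \<rho> t = {} then s else 0)" if "0 \<le> t" for t
      using sum[OF that] by (simp add: g_def)
    have gint: "g integrable_on {0..T}" for T
      unfolding g_def[abs_def]
      by (intro integrable_if_ge integrable_diff integrable_sum int insert.hyps integrable_const_ivl)
    have g0: "0 \<le> g t" if "0 \<le> t" for t using g[OF that] \<open>0 < s\<close> by simp
    define f where "f t = (if integral {0..t} g < l x then g t else 0)" for t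
    define \<rho>' where "\<rho>' = \<rho>(x := f)"
    have fint: "f integrable_on {0..T}" for T
      unfolding f_def[abs_def] by (rule integral_stopped(1)[OF gint g0])
    have fl: "integral {0..t} f < l x \<longleftrightarrow> integral {0..t} g < l x" if "0 \<le> t" for t
      unfolding f_def[abs_def] by (rule integral_stopped(2)[OF gint g0 that])
    have pnd': "pnd (insert x S) \<rho>' t =
        pnd S \<rho> t \<union> (if rel x \<le> t \<and> integral {0..t} g < l x then {x} else {})" if "0 \<le> t" for t
      using False fl[OF that] unfolding pnd_def \<rho>'_def by auto
    have subS: "pnd S \<rho> t \<subseteq> S" for t by (auto simp: pnd_def)
    have "\<rho>' y t = (if y \<in> pnd (insert x S) \<rho>' t \<and> (\<forall>z\<in>pnd (insert x S) \<rho>' t. \<kappa> y \<le> \<kappa> z) then s else 0)"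
      if t: "0 \<le> t" for t y
    proof (cases "y = x")
      case True
      have "(\<forall>z\<in>pnd (insert x S) \<rho>' t. \<kappa> x \<le> \<kappa> z) \<longleftrightarrow> pnd S \<rho> t = {}"
        using lt subS[of t] False unfolding pnd'[OF t] by (auto simp: not_le[symmetric])
      moreover have "x \<in> pnd (insert x S) \<rho>' t \<longleftrightarrow> rel x \<le> t \<and> integral {0..t} g < l x"
        unfolding pnd'[OF t] using subS[of t] False by auto
      ultimately show ?thesis using True g[OF t] by (simp add: \<rho>'_def f_def)
    next
      case yx: False
      have "y \<in> pnd (insert x S) \<rho>' t \<longleftrightarrow> y \<in> pnd S \<rho> t" using yx unfolding pnd'[OF t] by auto
      moreover have "(\<forall>z\<in>pnd (insert x S) \<rho>' t. \<kappa> y \<le> \<kappa> z) \<longleftrightarrow> (\<forall>z\<in>pnd S \<rho> t. \<kappa> y \<le> \<kappa> z)"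
        if "y \<in> pnd S \<rho> t"
        using lt[of y] yx subS[of t] that unfolding pnd'[OF t] by auto
      ultimately show ?thesis using \<rho>[OF t, of y] yx by (auto simp: \<rho>'_def)
    qed
    moreover have "\<rho>' y integrable_on {0..T}" for y T using int fint by (simp add: \<rho>'_def)
    ultimately show ?thesis by blast
  qed
qed

text \<open>The priorities refine the pair (deadline, release date), so that a copy is not preempted by a
  later one with the same deadline.\<close>

lemma edf_exists:
  assumes fin: "finite (released_copies P r)" and "0 < s"
  shows "\<exists>\<rho>. edf s \<delta> P r \<rho>"
proof -
  define D where "D = released_copies P r"
  define rel dl where "rel = release P r" and "dl = deadline \<delta> P r"
  obtain e :: "'a \<times> nat \<Rightarrow> nat" where e: "inj_on e D"
    using finite_imp_inj_to_nat_seg[OF fin] unfolding D_def by blast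
  define prec where "prec y x \<longleftrightarrow> dl y < dl x \<or> dl y = dl x \<and> (rel y < rel x \<or> rel y = rel x \<and> e y < e x)" for x y
  define \<kappa> where "\<kappa> x = card {y \<in> D. prec y x}" for x
  have mono: "\<kappa> x < \<kappa> y" if "x \<in> D" "prec x y" for x y
  proof -
    have "{z \<in> D. prec z x} \<subset> {z \<in> D. prec z y}"
      using that by (auto simp: prec_def)
    then show ?thesis unfolding \<kappa>_def using fin by (intro psubset_card_mono) (auto simp: D_def)
  qed
  have inj: "inj_on \<kappa> D"
  proof (rule inj_onI)
    fix x y assume xy: "x \<in> D" "y \<in> D" "\<kappa> x = \<kappa> y"
    then have "\<not> prec x y" "\<not> prec y x" using mono[of x y] mono[of y x] by auto
    then have "e x = e y" by (auto simp: prec_def)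
    then show "x = y" using e xy by (simp add: inj_on_eq_iff)
  qed
  have le: "dl x \<le> dl y \<and> (dl x = dl y \<longrightarrow> rel x \<le> rel y)" if "y \<in> D" "\<kappa> x \<le> \<kappa> y" for x y
    using mono[of y x] that by (force simp: prec_def)
  obtain \<rho> where int: "\<And>x T. \<rho> x integrable_on {0..T}"
    and \<rho>0: "\<forall>t\<ge>0. \<forall>x. \<rho> x t = (if x \<in> {x \<in> D. rel x \<le> t \<and> integral {0..t} (\<rho> x) < len P (fst x)} \<and>
      (\<forall>y\<in>{x \<in> D. rel x \<le> t \<and> integral {0..t} (\<rho> x) < len P (fst x)}. \<kappa> x \<le> \<kappa> y) then s else 0)"
    using priority_schedule_exists[OF fin[folded D_def] inj \<open>0 < s\<close>, of rel "\<lambda>x. len P (fst x)"] by blast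
  define pnd where "pnd t = pending P r \<rho> t" for t
  have pnd: "pnd t = {x \<in> D. rel x \<le> t \<and> integral {0..t} (\<rho> x) < len P (fst x)}" for t
    by (simp add: pnd_def pending_def sent_def D_def rel_def)
  have \<rho>: "\<rho> x t = (if x \<in> pnd t \<and> (\<forall>y\<in>pnd t. \<kappa> x \<le> \<kappa> y) then s else 0)" if "0 \<le> t" for x t
    using \<rho>0 that unfolding pnd by blast
  have \<rho>_nonneg: "0 \<le> \<rho> x t" if "0 \<le> t" for x t using \<rho>[OF that, of x] \<open>0 < s\<close> by simp
  have "edf s \<delta> P r \<rho>"
    unfolding edf_def pnd_def[symmetric] D_def[symmetric] rel_def[symmetric] dl_def[symmetric]
  proof (intro conjI allI impI)
    fix t x assume "0 \<le> t" "pnd t = {}" then show "\<rho> x t = 0" using \<rho>[of t x] by simp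
  next
    fix t :: real assume t: "0 \<le> t" and ne: "pnd t \<noteq> {}"
    have finp: "finite (pnd t)" using fin by (simp add: pnd D_def)
    obtain z where z: "z \<in> pnd t" "\<And>y. y \<in> pnd t \<Longrightarrow> \<kappa> z \<le> \<kappa> y"
      using ne finp by (metis arg_min_if_finite(1) arg_min_least)
    have "\<rho> y t = 0" if "y \<noteq> z" for y
    proof -
      have "\<not> (y \<in> pnd t \<and> \<kappa> y \<le> \<kappa> z)"
        using z inj that unfolding pnd by (metis (no_types, lifting) dual_order.antisym inj_on_eq_iff mem_Collect_eq)
      then show ?thesis using \<rho>[OF t, of y] z(1) by auto
    qed
    moreover have "dl z \<le> dl y" if "y \<in> pnd t" for y using le[of y z] z(2)[OF that] that by (simp add: pnd)
    moreover have "\<rho> z t = s" using \<rho>[OF t, of z] z by simp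
    ultimately show "\<exists>x\<in>pnd t. (\<forall>y\<in>pnd t. dl x \<le> dl y) \<and> \<rho> x t = s \<and> (\<forall>y. y \<noteq> x \<longrightarrow> \<rho> y t = 0)"
      using z(1) by blast
  next
    fix x t u assume A: "0 \<le> t \<and> t < u \<and> 0 < \<rho> x t \<and> x \<in> pnd u \<and>
       \<not> (\<exists>y\<in>D. t < rel y \<and> rel y \<le> u \<and> dl y < dl x)"
    then have x: "x \<in> pnd t" "\<And>y. y \<in> pnd t \<Longrightarrow> \<kappa> x \<le> \<kappa> y" using \<rho>[of t x] by (auto split: if_splits)
    have "\<kappa> x \<le> \<kappa> y" if y: "y \<in> pnd u" for y
    proof (cases "rel y \<le> t")
      case True
      have "integral {0..t} (\<rho> y) \<le> integral {0..u} (\<rho> y)"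
        using A int \<rho>_nonneg by (intro integral_subset_le) auto
      then have "y \<in> pnd t" using y True unfolding pnd by auto
      then show ?thesis by (rule x(2))
    next
      case False
      then have "dl x \<le> dl y" "rel x < rel y" using A y x(1) unfolding pnd by force+
      then have "\<not> \<kappa> y \<le> \<kappa> x" using le[of x y] x(1) by (auto simp: pnd)
      then show ?thesis by simp
    qed
    then show "0 < \<rho> x u" using \<rho>[of u x] A \<open>0 < s\<close> by auto
  qed (use int in auto)
  then show ?thesis by blast
qed

section \<open>Competitiveness of B-EquiSet-Edf\<close>

lemma flow_time_cases:
  assumes valid: "valid_instance P" and v: "is_schedule P s v"
  shows "flow_time P (broadcasts_of P v) = \<infinity> \<or>
    (\<exists>d. (\<forall>j<num_requests P. request_completion P (broadcasts_of P v) j = ereal (d j)) \<and>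
      flow_time P (broadcasts_of P v) = ereal (\<Sum>j<num_requests P. d j - arrival P j))"
proof -
  let ?c = "request_completion P (broadcasts_of P v)"
  have ge: "ereal (arrival P j) \<le> ?c j" if j: "j < num_requests P" for j
  proof -
    have ne: "request P j \<noteq> {}" and sub: "request P j \<subseteq> items P" and fin: "finite (request P j)"
      using valid j by (auto simp: valid_instance_def intro: finite_subset)
    obtain i where i: "i \<in> request P j" using ne by blast
    then have "ereal (arrival P j) \<le> reception_date (broadcasts_of P v i) (arrival P j)"
      using broadcast_item.reception_ge[OF is_schedule_item[OF valid v]] sub by auto
    also have "\<dots> \<le> ?c j" unfolding request_completion_def using fin i by (intro Max_ge) auto
    finally show ?thesis .
  qed
  show ?thesis
  proof (cases "\<exists>j<num_requests P. ?c j = \<infinity>")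
    case True
    then obtain j where "j < num_requests P" "?c j = \<infinity>" by blast
    then have "\<exists>j\<in>{..<num_requests P}. ?c j - ereal (arrival P j) = \<infinity>" by (intro bexI[of _ j]) auto
    then have "flow_time P (broadcasts_of P v) = \<infinity>" unfolding flow_time_def sum_Pinfty by simp
    then show ?thesis by simp
  next
    case False
    define d where "d j = real_of_ereal (?c j)" for j
    have d: "?c j = ereal (d j)" if "j < num_requests P" for j
      using False ge[OF that] that unfolding d_def by (cases "?c j") auto
    then have "flow_time P (broadcasts_of P v) = (\<Sum>j<num_requests P. ereal (d j - arrival P j))"
      unfolding flow_time_def by (intro sum.cong) auto
    then show ?thesis using d by auto
  qed
qed

lemma b_equiset_edf_flow_time:
  fixes \<delta> \<epsilon> :: real
  assumes "0 < \<delta>" "0 < \<epsilon>" and run: "edf_run P ((4 + \<epsilon>) * (1 + \<delta>)) w s \<delta> \<rho>"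
  shows "flow_time P (copy_broadcasts_of P \<rho>) \<le> ereal ((2 + 8 / \<epsilon>) * (1 + 1 / \<delta>)\<^sup>2) * BOPT 1 P"
proof -
  define \<sigma> where "\<sigma> = (4 + \<epsilon>) * (1 + \<delta>)"
  interpret edf_run P \<sigma> w s \<delta> \<rho> using run by (simp add: \<sigma>_def)
  define c where "c = (2 + 8 / \<epsilon>) * (1 + 1 / \<delta>)\<^sup>2"
  define F where "F = (\<Sum>j<q. ctime j - a j)"
  have c0: "0 < c" unfolding c_def using assms by (intro mult_pos_pos zero_less_power) (auto intro: add_pos_pos)
  have "4 + \<epsilon> \<le> \<sigma>" unfolding \<sigma>_def using assms by simp
  have "flow_time P (copy_broadcasts_of P \<rho>) / ereal c \<le> flow_time P (broadcasts_of P v)"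
    if v: "is_schedule P 1 v" for v
    using flow_time_cases[OF valid v]
  proof (elim disjE exE conjE)
    fix d assume d: "\<forall>j<q. request_completion P (broadcasts_of P v) j = ereal (d j)"
      and flow: "flow_time P (broadcasts_of P v) = ereal (\<Sum>j<q. d j - a j)"
    define D where "D = (\<Sum>j<q. d j - a j)"
    have FD: "(\<sigma> - 4) * F \<le> 2 * \<sigma> * D" unfolding F_def D_def by (rule flow_competitive[OF v]) (use d in simp)
    have "0 \<le> F" unfolding F_def using request_completion_eq(2) by (intro sum_nonneg) auto
    then have "0 \<le> (\<sigma> - 4) * F" using \<open>4 + \<epsilon> \<le> \<sigma>\<close> assms by simp
    then have "0 \<le> D" using FD \<sigma>_pos by (smt (verit) mult_pos_neg)
    have "F \<le> (2 * \<sigma> / (\<sigma> - 4)) * D" using FD \<open>4 + \<epsilon> \<le> \<sigma>\<close> assms by (simp add: field_simps)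
    also have "2 * \<sigma> / (\<sigma> - 4) = 2 + 8 / (\<sigma> - 4)" using \<open>4 + \<epsilon> \<le> \<sigma>\<close> assms by (simp add: field_simps)
    also have "(2 + 8 / (\<sigma> - 4)) * D \<le> (2 + 8 / \<epsilon>) * D"
      using \<open>4 + \<epsilon> \<le> \<sigma>\<close> assms \<open>0 \<le> D\<close> by (intro mult_right_mono add_left_mono divide_left_mono) auto
    finally have "(1 + 1 / \<delta>) * F \<le> (1 + 1 / \<delta>) * ((2 + 8 / \<epsilon>) * D)"
      using assms by (intro mult_left_mono) auto
    also have "\<dots> \<le> (1 + 1 / \<delta>)\<^sup>2 * ((2 + 8 / \<epsilon>) * D)"
      using assms \<open>0 \<le> D\<close> by (intro mult_right_mono self_le_power) auto
    also have "\<dots> = c * D" by (simp add: c_def)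
    finally have "flow_time P (copy_broadcasts_of P \<rho>) \<le> ereal (c * D)"
      using copy_flow_time unfolding F_def by (meson ereal_less_eq(3) order_trans)
    then show "flow_time P (copy_broadcasts_of P \<rho>) / ereal c \<le> flow_time P (broadcasts_of P v)"
      unfolding flow D_def[symmetric] using c0 by (simp add: ereal_divide_le_pos)
  qed auto
  then have "flow_time P (copy_broadcasts_of P \<rho>) / ereal c \<le> BOPT 1 P"
    unfolding BOPT_def by (intro INF_greatest) auto
  then show ?thesis unfolding c_def[symmetric] using c0 by (simp add: ereal_divide_le_pos)
qed

theorem theorem2:
  fixes \<delta> \<epsilon> :: real
  assumes "\<delta> > 0" and "\<epsilon> > 0"
  shows "competitive ((1 + \<delta>)\<^sup>2 * (4 + \<epsilon>)) ((2 + 8 / \<epsilon>) * (1 + 1 / \<delta>)\<^sup>2)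
           (b_equiset_edf \<delta> \<epsilon> :: 'i algorithm) \<and>
         (\<forall>P :: 'i broadcast_instance. valid_instance P \<longrightarrow>
            (\<forall>\<rho>\<in>b_equiset_edf \<delta> \<epsilon> P.
               one_at_a_time \<rho> \<and> preempted_at_most_once_on_average P \<rho>))"
proof -
  define \<sigma> s where "\<sigma> = (4 + \<epsilon>) * (1 + \<delta>)" and "s = (4 + \<epsilon>) * (1 + \<delta>)\<^sup>2"
  have s: "s = \<sigma> * (1 + \<delta>)" "s / (1 + \<delta>) = \<sigma>" "s = (1 + \<delta>)\<^sup>2 * (4 + \<epsilon>)"
    using assms by (simp_all add: \<sigma>_def s_def power2_eq_square)
  have \<sigma>0: "0 < \<sigma>" unfolding \<sigma>_def using assms by (intro mult_pos_pos) auto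
  then have s0: "0 < s" unfolding s(1) using assms by (intro mult_pos_pos) auto
  have mem: "\<rho> \<in> b_equiset_edf \<delta> \<epsilon> P \<longleftrightarrow> (\<exists>w. b_equiset \<sigma> P w \<and> edf s \<delta> P (total_rate P w) \<rho>)"
    for \<rho> and P :: "'i broadcast_instance"
    unfolding b_equiset_edf_def Let_def s_def[symmetric] s(2) by simp
  have run: "\<exists>w. edf_run P \<sigma> w s \<delta> \<rho>" if valid: "valid_instance P" and \<rho>: "\<rho> \<in> b_equiset_edf \<delta> \<epsilon> P"
    for \<rho> and P :: "'i broadcast_instance"
    using \<rho> unfolding mem edf_run_def equiset_run_def edf_run_axioms_def using valid \<sigma>0 assms s(1) by auto
  have ne: "b_equiset_edf \<delta> \<epsilon> P \<noteq> {}" if valid: "valid_instance P" for P :: "'i broadcast_instance"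
  proof -
    obtain w where w: "b_equiset \<sigma> P w" using b_equiset_exists[OF valid \<sigma>0] by blast
    interpret equiset_run P \<sigma> w using valid \<sigma>0 w by unfold_locales
    obtain \<rho> where "edf s \<delta> P (total_rate P w) \<rho>" using edf_exists[OF finite_released s0] by blast
    then have "\<rho> \<in> b_equiset_edf \<delta> \<epsilon> P" unfolding mem using w by blast
    then show ?thesis by blast
  qed
  show ?thesis
    unfolding competitive_def s(3)[symmetric]
  proof (intro conjI allI impI ballI)
    fix P :: "'i broadcast_instance" and \<rho> assume "valid_instance P" "\<rho> \<in> b_equiset_edf \<delta> \<epsilon> P"
    then obtain w where w: "edf_run P \<sigma> w s \<delta> \<rho>" using run by blast
    show "is_copy_schedule P s \<rho>" by (rule edf_run.copy_schedule[OF w])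
    show "flow_time P (copy_broadcasts_of P \<rho>) \<le> ereal ((2 + 8 / \<epsilon>) * (1 + 1 / \<delta>)\<^sup>2) * BOPT 1 P"
      by (rule b_equiset_edf_flow_time[OF assms w[unfolded \<sigma>_def]])
    show "one_at_a_time \<rho>" by (rule edf_run.one_at_a_time[OF w])
    show "preempted_at_most_once_on_average P \<rho>" by (rule edf_run.preempted_at_most_once_on_average[OF w])
  qed (rule ne)
qed

end
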